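(* Let $k$ be a field, let $F$ be a field of characteristic zero containing all roots of unity in an algebraic closure $\overline{F}$ of $F$, and fix an injective homomorphism $\iota:\mu(F)=\mu(\overline{F})\hookrightarrow\mathbb{C}^\times$. For any point $x\in X_F\subset\mathfrak{X}_F(\mathbb{C})$ the map $\mathfrak{X}_F(\mathbb{C})\to X_F$ induced by $\chi\mapsto\chi/|\chi|$ induces an isomorphism of $k$-groups $$\pi_k(\mathfrak{X}_F(\mathbb{C}),x)\xrightarrow{\sim}\pi_k(X_F,x).$$
   Context: A $k$-group is an affine group scheme over $k$. For a connected topological space $Z$ and $z\in Z$, $\pi_k(Z,z)=\underline{\mathrm{Aut}}^\otimes(\omega_z)$ is the Tannakian dual of the category $\mathbf{Loc}_k(Z)$ of local systems of finite-dimensional $k$-vector spaces on $Z$, with fibre functor $\omega_z(\mathcal{E})=\mathcal{E}_z$; it is covariantly functorial in $(Z,z)$ via pullback of local systems. Kucharczyk–Scholze spaces. $\mu(F)$ is the group of roots of unity of $F$ and $G_F=\mathrm{Aut}_F(\overline{F})$. Let $W_{\mathrm{rat}}(F)$ be the ring of rational Witt vectors of $F$; the Teichmüller map induces $\mathbb{Z}[\overline{F}^\times]^{G_F}\cong W_{\mathrm{rat}}(F)$. Set $\mathfrak{X}_F=\mathrm{Spec}(W_{\mathrm{rat}}(F)\otimes_{\mathbb{Z}[\mu(F)]}\mathbb{C})$, where $\mathbb{Z}[\mu(F)]\to W_{\mathrm{rat}}(F)$ is given by the Teichmüller map and $\mathbb{Z}[\mu(F)]\to\mathbb{C}$ by $\iota$,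 and give $\mathfrak{X}_F(\mathbb{C})$ the complex topology induced from the topology of $\mathbb{C}$. There is a homeomorphism $\mathfrak{X}_F(\mathbb{C})=\mathfrak{X}_{\overline{F}}(\mathbb{C})/G_F$, where $\mathfrak{X}_{\overline{F}}(\mathbb{C})=\{\chi:\overline{F}^\times\to\mathbb{C}^\times \text{ homomorphism}\mid\chi|_{\mu(\overline{F})}=\iota\}$ carries the topology of pointwise convergence and the quotient carries the quotient topology. Let $S^1 \subset \mathbb{C}^\times$ be the unit circle, let $$X_{\overline{F}}=\{\chi\in\mathrm{Hom}(\overline{F}^\times,S^1)\mid\chi|_{\mu(F)}=\iota\}\subset\mathfrak{X}_{\overline{F}}(\mathbb{C})$$ (a closed subspace of the Pontrjagin dual of the discrete group $\overline{F}^\times$), and let $X_F=X_{\overline{F}}/G_F$ with the quotient topology, regarded as a subspace of $\mathfrak{X}_F(\mathbb{C})$. Both $\mathfrak{X}_F(\mathbb{C})$ and $X_F$ are connected. The $G_F$-equivariant map $\mathfrak{X}_{\overline{F}}(\mathbb{C})\to X_{\overline{F}}$, $\chi\mapsto\chi/|\chi|$, induces the map $\mathfrak{X}_F(\mathbb{C})\to X_F$ of the claim. *)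

theory Defs
  imports
    "HOL-Analysis.Analysis"
    "HOL-Algebra.Algebraic_Closure_Type"
    "HOL-Library.Function_Algebras"
    "HOL-Library.Nat_Bijection"
begin

section \<open>Coordinate modules\<close>

definition cscale :: "'r::comm_ring_1 \<Rightarrow> (nat \<Rightarrow> 'r) \<Rightarrow> nat \<Rightarrow> 'r"
  where "cscale c v = (\<lambda>i. c * v i)"

interpretation coord: Modules.module "cscale :: 'r::comm_ring_1 \<Rightarrow> (nat \<Rightarrow> 'r) \<Rightarrow> nat \<Rightarrow> 'r"
  by unfold_locales (auto simp: cscale_def fun_eq_iff algebra_simps)

text \<open>Finite-dimensional \<open>k\<close>-vector spaces are realised as finite-dimensional subspaces of
  \<open>k\<^sup>\<nat>\<close>; every finite-dimensional \<open>k\<close>-vector space is isomorphic to such a subspace, so nothing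
  is lost up to equivalence of categories.\<close>

definition fd_subspace :: "(nat \<Rightarrow> 'k::field) set \<Rightarrow> bool"
  where "fd_subspace V \<longleftrightarrow> (\<exists>B. finite B \<and> V = coord.span B)"

definition linear_on :: "(nat \<Rightarrow> 'r::comm_ring_1) set \<Rightarrow> ((nat \<Rightarrow> 'r) \<Rightarrow> nat \<Rightarrow> 'r) \<Rightarrow> bool"
  where "linear_on V f \<longleftrightarrow>
    (\<forall>x\<in>V. \<forall>y\<in>V. f (x + y) = f x + f y) \<and> (\<forall>c. \<forall>x\<in>V. f (cscale c x) = cscale c (f x))"

text \<open>The tensor product of two coordinate vectors, with \<open>k\<^sup>\<nat>\<^sup>\<times>\<^sup>\<nat>\<close> identified with \<open>k\<^sup>\<nat>\<close> by the
  pairing bijection.  For subspaces \<open>V\<close>, \<open>W\<close> the canonical map from \<open>V \<otimes> W\<close> to \<open>k\<^sup>\<nat>\<close> is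
  injective, so \<open>tensor_space V W\<close> is a model of \<open>V \<otimes> W\<close>.\<close>

definition tensor_vec :: "(nat \<Rightarrow> 'r::comm_ring_1) \<Rightarrow> (nat \<Rightarrow> 'r) \<Rightarrow> nat \<Rightarrow> 'r"
  where "tensor_vec u v = (\<lambda>n. u (fst (prod_decode n)) * v (snd (prod_decode n)))"

definition tensor_space :: "(nat \<Rightarrow> 'k::field) set \<Rightarrow> (nat \<Rightarrow> 'k) set \<Rightarrow> (nat \<Rightarrow> 'k) set"
  where "tensor_space V W = coord.span {tensor_vec u v |u v. u \<in> V \<and> v \<in> W}"

definition unit_space :: "(nat \<Rightarrow> 'k::field) set"
  where "unit_space = {v. \<forall>i. i \<noteq> 0 \<longrightarrow> v i = 0}"

text \<open>Unital ring homomorphisms between rings given by types.  A commutative \<open>k\<close>-algebra is a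
  commutative ring \<open>R\<close> with such a map \<open>s: k \<rightarrow> R\<close>.\<close>

abbreviation is_ring_hom :: "('r::comm_ring_1 \<Rightarrow> 'q::comm_ring_1) \<Rightarrow> bool"
  where "is_ring_hom f \<equiv> f \<in> ring_hom ring_of_type_algebra ring_of_type_algebra"

text \<open>\<open>V \<otimes>\<^sub>k R\<close>, realised inside \<open>R\<^sup>\<nat>\<close>; the pure tensor \<open>v \<otimes> 1\<close> is \<open>s \<circ> v\<close>.\<close>

definition base_change :: "('k::field \<Rightarrow> 'r::comm_ring_1) \<Rightarrow> (nat \<Rightarrow> 'k) set \<Rightarrow> (nat \<Rightarrow> 'r) set"
  where "base_change s V = coord.span ((\<lambda>v. s \<circ> v) ` V)"

text \<open>The \<open>R\<close>-linear map on \<open>V \<otimes>\<^sub>k R\<close> that extends a \<open>k\<close>-linear map \<open>f\<close> from \<open>V\<close> to an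
  \<open>R\<close>-module; see \<open>ex1_linear_extension\<close> for existence and uniqueness.\<close>

definition extend_scalars ::
  "('k::field \<Rightarrow> 'r::comm_ring_1) \<Rightarrow> (nat \<Rightarrow> 'k) set \<Rightarrow> ((nat \<Rightarrow> 'k) \<Rightarrow> nat \<Rightarrow> 'r)
    \<Rightarrow> (nat \<Rightarrow> 'r) \<Rightarrow> nat \<Rightarrow> 'r"
  where "extend_scalars s V f =
    (THE g. g \<in> extensional (base_change s V) \<and> linear_on (base_change s V) g \<and>
            (\<forall>v\<in>V. g (s \<circ> v) = f v))"

section \<open>Local systems\<close>

text \<open>A local system on \<open>Z\<close> is given by its stalks together with the topology on its etale space:
  a locally trivial family of finite-dimensional vector spaces with discrete fibres.\<close>

record ('z, 'k) local_sys =
  stalk :: "'z \<Rightarrow> (nat \<Rightarrow> 'k) set"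
  etale :: "('z \<times> (nat \<Rightarrow> 'k)) topology"

definition local_trivialization ::
  "'z topology \<Rightarrow> ('z, 'k::field) local_sys \<Rightarrow> 'z set \<Rightarrow> (nat \<Rightarrow> 'k) set
    \<Rightarrow> ('z \<Rightarrow> (nat \<Rightarrow> 'k) \<Rightarrow> nat \<Rightarrow> 'k) \<Rightarrow> bool"
  where "local_trivialization Z E U V \<phi> \<longleftrightarrow>
    (\<forall>u\<in>U. linear_on V (\<phi> u) \<and> bij_betw (\<phi> u) V (stalk E u)) \<and>
    homeomorphic_map (prod_topology (subtopology Z U) (discrete_topology V))
      (subtopology (etale E) (SIGMA u:U. stalk E u)) (\<lambda>(u, v). (u, \<phi> u v))"

text \<open>Stalks outside \<open>topspace Z\<close> are empty, so that a local system on \<open>Z\<close> carries no junk data.\<close>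

definition Loc :: "'z topology \<Rightarrow> ('z, 'k::field) local_sys set"
  where "Loc Z = {E.
    (\<forall>z. z \<notin> topspace Z \<longrightarrow> stalk E z = {}) \<and>
    (\<forall>z\<in>topspace Z. fd_subspace (stalk E z)) \<and>
    topspace (etale E) = (SIGMA z:topspace Z. stalk E z) \<and>
    continuous_map (etale E) Z fst \<and>
    (\<forall>z\<in>topspace Z. \<exists>U V \<phi>. openin Z U \<and> z \<in> U \<and> fd_subspace V \<and>
        local_trivialization Z E U V \<phi>)}"

definition Loc_hom :: "'z topology \<Rightarrow> ('z, 'k::field) local_sys \<Rightarrow> ('z, 'k) local_sys
    \<Rightarrow> ('z \<Rightarrow> (nat \<Rightarrow> 'k) \<Rightarrow> nat \<Rightarrow> 'k) set"
  where "Loc_hom Z E E' = {\<phi>.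
    (\<forall>z\<in>topspace Z. linear_on (stalk E z) (\<phi> z) \<and> \<phi> z ` stalk E z \<subseteq> stalk E' z) \<and>
    continuous_map (etale E) (etale E') (\<lambda>(z, v). (z, \<phi> z v))}"

definition Loc_unit :: "'z topology \<Rightarrow> ('z, 'k::field) local_sys"
  where "Loc_unit Z = \<lparr>
    stalk = (\<lambda>z. if z \<in> topspace Z then unit_space else {}),
    etale = prod_topology Z (discrete_topology unit_space)\<rparr>"

definition sections_over :: "'z topology \<Rightarrow> ('z, 'k::field) local_sys \<Rightarrow> 'z set
    \<Rightarrow> ('z \<Rightarrow> nat \<Rightarrow> 'k) set"
  where "sections_over Z E U =
    {\<sigma>. continuous_map (subtopology Z U) (etale E) (\<lambda>z. (z, \<sigma> z))}"

text \<open>The etale space of the tensor product is that of the sheafification of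
  \<open>U \<mapsto> E(U) \<otimes> E'(U)\<close>: a basis of open sets is given by the images of the sections
  \<open>\<Sum>\<^sub>i \<sigma>\<^sub>i \<otimes> \<tau>\<^sub>i\<close> over open sets.\<close>

definition Loc_tensor :: "'z topology \<Rightarrow> ('z, 'k::field) local_sys \<Rightarrow> ('z, 'k) local_sys
    \<Rightarrow> ('z, 'k) local_sys"
  where "Loc_tensor Z E E' = \<lparr>
    stalk = (\<lambda>z. if z \<in> topspace Z then tensor_space (stalk E z) (stalk E' z) else {}),
    etale = topology_generated_by
      {(\<lambda>z. (z, \<Sum>i<n. tensor_vec (\<sigma> i z) (\<tau> i z))) ` U |U (n::nat) \<sigma> \<tau>.
        openin Z U \<and> (\<forall>i<n. \<sigma> i \<in> sections_over Z E U \<and> \<tau> i \<in> sections_over Z E' U)}\<rparr>"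

text \<open>The etale space of the pullback along \<open>f\<close> is the fibre product of \<open>Z\<close> with the etale space.\<close>

definition Loc_pullback :: "'z topology \<Rightarrow> ('z \<Rightarrow> 'w) \<Rightarrow> ('w, 'k::field) local_sys
    \<Rightarrow> ('z, 'k) local_sys"
  where "Loc_pullback Z f E = \<lparr>
    stalk = (\<lambda>z. if z \<in> topspace Z then stalk E (f z) else {}),
    etale = pullback_topology (SIGMA z:topspace Z. stalk E (f z))
              (\<lambda>(z, v). (z, (f z, v))) (prod_topology Z (etale E))\<rparr>"

section \<open>The Tannakian dual\<close>

text \<open>The functor of points \<open>R \<mapsto> Aut\<^sup>\<otimes>(\<omega>\<^sub>z)(R)\<close>: families of \<open>R\<close>-linear automorphisms of the
  \<open>R\<close>-modules \<open>E\<^sub>z \<otimes>\<^sub>k R\<close>, natural in \<open>E\<close> and compatible with tensor products and the unit object.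
  A commutative \<open>k\<close>-algebra is a type \<open>'r\<close> of class \<open>comm_ring_1\<close> with a structure map \<open>s\<close>
  (the zero ring, at which the functor is trivial, is not of this form).  The condition on tensor
  products is stated on pure tensors, which determines the map by \<open>R\<close>-linearity.\<close>

definition tensor_automorphisms ::
  "'z topology \<Rightarrow> 'z \<Rightarrow> ('k::field \<Rightarrow> 'r::comm_ring_1)
    \<Rightarrow> (('z, 'k) local_sys \<Rightarrow> (nat \<Rightarrow> 'r) \<Rightarrow> nat \<Rightarrow> 'r) set"
  where "tensor_automorphisms Z z s = {\<alpha>.
    \<alpha> \<in> extensional (Loc Z) \<and>
    (\<forall>E\<in>Loc Z.
      \<alpha> E \<in> extensional (base_change s (stalk E z)) \<and>
      linear_on (base_change s (stalk E z)) (\<alpha> E) \<and>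
      bij_betw (\<alpha> E) (base_change s (stalk E z)) (base_change s (stalk E z))) \<and>
    (\<forall>E\<in>Loc Z. \<forall>E'\<in>Loc Z. \<forall>\<phi>\<in>Loc_hom Z E E'. \<forall>x\<in>base_change s (stalk E z).
      \<alpha> E' (extend_scalars s (stalk E z) (\<lambda>v. s \<circ> \<phi> z v) x)
        = extend_scalars s (stalk E z) (\<lambda>v. s \<circ> \<phi> z v) (\<alpha> E x)) \<and>
    (\<forall>E\<in>Loc Z. \<forall>E'\<in>Loc Z.
      \<forall>x\<in>base_change s (stalk E z). \<forall>y\<in>base_change s (stalk E' z).
        \<alpha> (Loc_tensor Z E E') (tensor_vec x y) = tensor_vec (\<alpha> E x) (\<alpha> E' y)) \<and>
    (\<forall>x\<in>base_change s unit_space. \<alpha> (Loc_unit Z) x = x)}"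

definition tannaka_group ::
  "'z topology \<Rightarrow> 'z \<Rightarrow> ('k::field \<Rightarrow> 'r::comm_ring_1)
    \<Rightarrow> (('z, 'k) local_sys \<Rightarrow> (nat \<Rightarrow> 'r) \<Rightarrow> nat \<Rightarrow> 'r) monoid"
  where "tannaka_group Z z s = \<lparr>
    carrier = tensor_automorphisms Z z s,
    monoid.mult = (\<lambda>\<alpha> \<beta>. \<lambda>E\<in>Loc Z. compose (base_change s (stalk E z)) (\<alpha> E) (\<beta> E)),
    one = (\<lambda>E\<in>Loc Z. \<lambda>x\<in>base_change s (stalk E z). x)\<rparr>"

text \<open>Functoriality in the \<open>k\<close>-algebra: the map \<open>Aut\<^sup>\<otimes>(\<omega>\<^sub>z)(R) \<rightarrow> Aut\<^sup>\<otimes>(\<omega>\<^sub>z)(R')\<close> given by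
  extension of scalars along \<open>g: R \<rightarrow> R'\<close>, where \<open>R'\<close> has structure map \<open>g \<circ> s\<close>.\<close>

definition tannaka_base_change ::
  "'z topology \<Rightarrow> 'z \<Rightarrow> ('k::field \<Rightarrow> 'r::comm_ring_1) \<Rightarrow> ('r \<Rightarrow> 'q::comm_ring_1)
    \<Rightarrow> (('z, 'k) local_sys \<Rightarrow> (nat \<Rightarrow> 'r) \<Rightarrow> nat \<Rightarrow> 'r)
    \<Rightarrow> (('z, 'k) local_sys \<Rightarrow> (nat \<Rightarrow> 'q) \<Rightarrow> nat \<Rightarrow> 'q)"
  where "tannaka_base_change Z z s g \<alpha> =
    (\<lambda>E\<in>Loc Z. extend_scalars (g \<circ> s) (stalk E z) (\<lambda>v. g \<circ> \<alpha> E (s \<circ> v)))"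

text \<open>Functoriality in the space: the map on \<open>R\<close>-points from the dual of \<open>(Z, z)\<close> to that of
  \<open>(W, f z)\<close> induced by \<open>f: Z \<rightarrow> W\<close>.  It uses that the stalk of the pullback at \<open>z\<close> is the stalk
  at \<open>f z\<close>.  By the Yoneda lemma, a map of affine \<open>k\<close>-group schemes is an isomorphism iff it is
  an isomorphism of groups on \<open>R\<close>-points for every \<open>k\<close>-algebra \<open>R\<close>; quantification over \<open>R\<close> is
  quantification over the type \<open>'r\<close> and the structure map.\<close>

definition tannaka_map ::
  "'z topology \<Rightarrow> 'w topology \<Rightarrow> ('z \<Rightarrow> 'w)
    \<Rightarrow> (('z, 'k::field) local_sys \<Rightarrow> (nat \<Rightarrow> 'r::comm_ring_1) \<Rightarrow> nat \<Rightarrow> 'r)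
    \<Rightarrow> (('w, 'k) local_sys \<Rightarrow> (nat \<Rightarrow> 'r) \<Rightarrow> nat \<Rightarrow> 'r)"
  where "tannaka_map Z W f \<alpha> = (\<lambda>E\<in>Loc W. \<alpha> (Loc_pullback Z f E))"

section \<open>The spaces of Kucharczyk and Scholze\<close>

definition quotient_topology :: "'a topology \<Rightarrow> ('a \<Rightarrow> 'b) \<Rightarrow> 'b topology"
  where "quotient_topology T q =
    topology (\<lambda>U. U \<subseteq> q ` topspace T \<and> openin T {x \<in> topspace T. q x \<in> U})"

definition roots_of_unity :: "'a::field set"
  where "roots_of_unity = {\<zeta>. \<exists>n>0. \<zeta> ^ n = 1}"

definition galois_group :: "'a::field set \<Rightarrow> ('a \<Rightarrow> 'a) set"
  where "galois_group F =
    {\<gamma> \<in> ring_iso ring_of_type_algebra ring_of_type_algebra. \<forall>a\<in>F. \<gamma> a = a}"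

text \<open>Homomorphisms \<open>\<psi>\<close> from the multiplicative group of the algebraically closed field \<open>'a\<close> to the
  nonzero complex numbers with \<open>\<psi> = \<iota>\<close> on roots of unity, in the topology of pointwise
  convergence.\<close>

definition KS_characters :: "('a::field \<Rightarrow> complex) \<Rightarrow> ('a \<Rightarrow> complex) set"
  where "KS_characters \<iota> = {\<psi> \<in> ((UNIV - {0}) \<rightarrow>\<^sub>E (UNIV - {0})).
    (\<forall>a b. a \<noteq> 0 \<longrightarrow> b \<noteq> 0 \<longrightarrow> \<psi> (a * b) = \<psi> a * \<psi> b) \<and>
    (\<forall>\<zeta>\<in>roots_of_unity. \<psi> \<zeta> = \<iota> \<zeta>)}"

definition KS_closure :: "('a::field \<Rightarrow> complex) \<Rightarrow> ('a \<Rightarrow> complex) topology"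
  where "KS_closure \<iota> =
    subtopology (product_topology (\<lambda>_. euclidean) (UNIV - {0})) (KS_characters \<iota>)"

definition KS_unitary_closure :: "('a::field \<Rightarrow> complex) \<Rightarrow> ('a \<Rightarrow> complex) topology"
  where "KS_unitary_closure \<iota> =
    subtopology (KS_closure \<iota>) {\<psi>. \<forall>a. a \<noteq> 0 \<longrightarrow> \<psi> a \<in> sphere 0 1}"

definition galois_orbit :: "'a::field set \<Rightarrow> ('a \<Rightarrow> complex) \<Rightarrow> ('a \<Rightarrow> complex) set"
  where "galois_orbit F \<psi> = {\<psi> \<circ> \<gamma> |\<gamma>. \<gamma> \<in> galois_group F}"

text \<open>The space of complex points of \<open>Spec (W\<^sub>r\<^sub>a\<^sub>t(F) \<otimes> \<complex>)\<close>, through its homeomorphism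
  (due to Kucharczyk and Scholze) with the quotient of the space of characters by the Galois
  group.  A point of \<open>X\<^sub>F\<close> (here \<open>KS_compact_space\<close>) is the orbit of a unitary character and hence
  literally also a point of \<open>KS_space\<close>.\<close>

definition KS_space :: "'a::field set \<Rightarrow> ('a \<Rightarrow> complex) \<Rightarrow> ('a \<Rightarrow> complex) set topology"
  where "KS_space F \<iota> = quotient_topology (KS_closure \<iota>) (galois_orbit F)"

definition KS_compact_space :: "'a::field set \<Rightarrow> ('a \<Rightarrow> complex) \<Rightarrow> ('a \<Rightarrow> complex) set topology"
  where "KS_compact_space F \<iota> = quotient_topology (KS_unitary_closure \<iota>) (galois_orbit F)"

definition unitarize :: "('a::field \<Rightarrow> complex) \<Rightarrow> 'a \<Rightarrow> complex"
  where "unitarize \<psi> = (\<lambda>a\<in>UNIV - {0}. \<psi> a / complex_of_real (cmod (\<psi> a)))"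

text \<open>The map on orbits induced by \<open>\<psi> \<mapsto> \<psi> / |\<psi>|\<close>; see \<open>KS_retraction_orbit\<close>.\<close>

definition KS_retraction :: "('a::field \<Rightarrow> complex) set \<Rightarrow> ('a \<Rightarrow> complex) set"
  where "KS_retraction P = unitarize ` P"

section \<open>Well-definedness\<close>

lemma sum_fun_eval: "sum h A i = (\<Sum>a\<in>A. h a i)" for h :: "'b \<Rightarrow> nat \<Rightarrow> 'c::comm_monoid_add"
  by (induction A rule: infinite_finite_induct) auto

text \<open>Reduced echelon form: a finite-dimensional subspace of \<open>k\<^sup>\<nat>\<close> has a basis dual to finitely many
  coordinate functions.\<close>

lemma fd_subspace_echelon:
  fixes V :: "(nat \<Rightarrow> 'k::field) set"
  assumes "fd_subspace V"
  obtains I b where "finite I" "\<And>p. p \<in> I \<Longrightarrow> b p \<in> V"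
    "\<And>p q. p \<in> I \<Longrightarrow> q \<in> I \<Longrightarrow> b p q = (if p = q then 1 else 0)"
    "\<And>v. v \<in> V \<Longrightarrow> v = (\<Sum>p\<in>I. cscale (v p) (b p))"
proof -
  obtain B where "finite B" and V: "V = coord.span B"
    using assms by (auto simp: fd_subspace_def)
  from \<open>finite B\<close> have "\<exists>I b. finite I \<and> (\<forall>p\<in>I. b p \<in> coord.span B) \<and>
      (\<forall>p\<in>I. \<forall>q\<in>I. b p q = (if p = q then 1 else 0)) \<and>
      (\<forall>v\<in>coord.span B. v = (\<Sum>p\<in>I. cscale (v p) (b p)))"
  proof (induction B rule: finite_induct)
    case empty
    show ?case
      by (rule exI[of _ "{}"]) auto
  next
    case (insert w B)
    then obtain I b where fin: "finite I" and bB: "\<forall>p\<in>I. b p \<in> coord.span B"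
      and dual: "\<forall>p\<in>I. \<forall>q\<in>I. b p q = (if p = q then 1 else 0)"
      and exp: "\<forall>v\<in>coord.span B. v = (\<Sum>p\<in>I. cscale (v p) (b p))"
      by blast
    define w' where "w' = w - (\<Sum>p\<in>I. cscale (w p) (b p))"
    have mono: "coord.span B \<subseteq> coord.span (insert w B)"
      by (rule coord.span_mono) auto
    have sumB: "(\<Sum>p\<in>I. cscale (w p) (b p)) \<in> coord.span B"
      using bB by (intro coord.span_sum coord.span_scale) auto
    show ?case
    proof (cases "w' = 0")
      case True
      then have "w \<in> coord.span B"
        using sumB by (simp add: w'_def)
      then have "insert w B \<subseteq> coord.span B"
        using coord.span_superset by blast
      then have "coord.span (insert w B) \<subseteq> coord.span B"
        by (rule coord.span_minimal) (rule coord.subspace_span)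
      then have "coord.span (insert w B) = coord.span B"
        using mono by blast
      show ?thesis
        unfolding \<open>coord.span (insert w B) = coord.span B\<close>
        by (intro exI[of _ I] exI[of _ b] conjI fin bB dual exp)
    next
      case False
      then obtain j where j: "w' j \<noteq> 0"
        by (auto simp: fun_eq_iff)
      have w'I: "w' q = 0" if "q \<in> I" for q
      proof -
        have "(\<Sum>p\<in>I. w p * b p q) = (\<Sum>p\<in>I. if p = q then w q else 0)"
          using that dual by (intro sum.cong) auto
        then show ?thesis
          using that fin by (simp add: w'_def sum_fun_eval cscale_def)
      qed
      with j have jI: "j \<notin> I" by auto
      define c where "c = cscale (1 / w' j) w'"
      have c: "c j = 1" "\<And>q. q \<in> I \<Longrightarrow> c q = 0"
        using j w'I by (auto simp: c_def cscale_def)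
      define b' where "b' = (\<lambda>p. if p = j then c else b p - cscale (b p j) c)"
      have "w' \<in> coord.span (insert w B)"
        unfolding w'_def using subsetD[OF mono sumB]
        by (intro coord.span_diff coord.span_base[OF insertI1])
      then have cS: "c \<in> coord.span (insert w B)"
        unfolding c_def by (rule coord.span_scale)
      have b'S: "\<forall>p\<in>insert j I. b' p \<in> coord.span (insert w B)"
        using cS bB mono by (auto simp: b'_def intro!: coord.span_diff coord.span_scale)
      have dual': "\<forall>p\<in>insert j I. \<forall>q\<in>insert j I. b' p q = (if p = q then 1 else 0)"
        using dual c jI by (auto simp: b'_def cscale_def)
      have "v = (\<Sum>p\<in>insert j I. cscale (v p) (b' p))"
        if v: "v \<in> coord.span (insert w B)" for v
      proof -
        obtain k where k: "v - cscale k w \<in> coord.span B"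
          using v by (auto simp: coord.span_insert)
        have uexp: "v - cscale k w = (\<Sum>p\<in>I. cscale ((v - cscale k w) p) (b p))"
          using exp k by blast
        have vm: "v m = k * w' m + (\<Sum>p\<in>I. v p * b p m)" for m
        proof -
          have "v m - k * w m = (\<Sum>p\<in>I. (v p - k * w p) * b p m)"
            using fun_cong[OF uexp, of m] by (simp add: sum_fun_eval cscale_def)
          also have "\<dots> = (\<Sum>p\<in>I. v p * b p m) - k * (\<Sum>p\<in>I. w p * b p m)"
            by (simp add: algebra_simps sum_subtractf sum_distrib_left)
          finally show ?thesis
            by (simp add: w'_def sum_fun_eval cscale_def algebra_simps)
        qed
        have "(\<Sum>p\<in>insert j I. cscale (v p) (b' p)) m = v m" for m
        proof -
          have "(\<Sum>p\<in>insert j I. cscale (v p) (b' p)) m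
              = v j * c m + (\<Sum>p\<in>I. v p * (b p m - b p j * c m))"
            using fin jI by (auto simp: sum_fun_eval cscale_def b'_def intro!: sum.cong)
          also have "(\<Sum>p\<in>I. v p * (b p m - b p j * c m))
              = (\<Sum>p\<in>I. v p * b p m) - (\<Sum>p\<in>I. v p * b p j) * c m"
            by (simp add: algebra_simps sum_subtractf sum_distrib_left)
          also have "v j * c m + \<dots> = (v j - (\<Sum>p\<in>I. v p * b p j)) * c m + (\<Sum>p\<in>I. v p * b p m)"
            by (simp add: algebra_simps)
          also have "v j - (\<Sum>p\<in>I. v p * b p j) = k * w' j"
            using vm[of j] by simp
          also have "k * w' j * c m = k * w' m"
            using j by (simp add: c_def cscale_def)
          finally show ?thesis
            using vm[of m] by simp
        qed
        then show ?thesis by auto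
      qed
      then show ?thesis
        using fin b'S dual' by (intro exI[of _ "insert j I"] exI[of _ b']) blast
    qed
  qed
  then obtain I b where "finite I" "\<forall>p\<in>I. b p \<in> coord.span B"
    "\<forall>p\<in>I. \<forall>q\<in>I. b p q = (if p = q then 1 else 0)"
    "\<forall>v\<in>coord.span B. v = (\<Sum>p\<in>I. cscale (v p) (b p))"
    by (elim exE conjE)
  then show thesis
    by (intro that[of I b]) (unfold V, blast+)
qed

lemma is_ring_hom_zero:
  assumes "is_ring_hom s"
  shows "s 0 = 0"
proof -
  have add: "s (x + y) = s x + s y" for x y
    using assms by (simp add: ring_hom_def ring_of_type_algebra_def)
  have "s 0 + s 0 = s (0 + 0)"
    by (rule add[symmetric])
  also have "\<dots> = s 0 + 0"
    by simp
  finally show ?thesis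
    by (simp only: add_left_cancel)
qed

lemma ex1_linear_extension:
  fixes s :: "'k::field \<Rightarrow> 'r::comm_ring_1"
  assumes s: "is_ring_hom s" and V: "fd_subspace V"
    and add: "\<forall>u\<in>V. \<forall>v\<in>V. f (u + v) = f u + f v"
    and scale: "\<forall>c. \<forall>v\<in>V. f (cscale c v) = cscale (s c) (f v)"
  shows "\<exists>!g. g \<in> extensional (base_change s V) \<and> linear_on (base_change s V) g \<and>
    (\<forall>v\<in>V. g (s \<circ> v) = f v)"
proof -
  let ?M = "base_change s V"
  obtain I b where fin: "finite I" and bV: "\<And>p. p \<in> I \<Longrightarrow> b p \<in> V"
    and exp: "\<And>v. v \<in> V \<Longrightarrow> v = (\<Sum>p\<in>I. cscale (v p) (b p))"
    using fd_subspace_echelon[OF V] by metis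
  obtain B where B: "V = coord.span B"
    using V by (auto simp: fd_subspace_def)
  have zero: "0 \<in> V"
    unfolding B by (rule coord.span_zero)
  have f0: "f 0 = 0"
    using add[rule_format, OF zero zero] by simp
  have fsum: "(\<Sum>p\<in>J. cscale (c p) (b p)) \<in> V \<and>
      f (\<Sum>p\<in>J. cscale (c p) (b p)) = (\<Sum>p\<in>J. cscale (s (c p)) (f (b p)))"
    if "J \<subseteq> I" for J c
    using finite_subset[OF that fin] that
  proof (induction J rule: finite_induct)
    case empty
    then show ?case using zero f0 unfolding sum.empty by blast
  next
    case (insert p J)
    let ?u = "cscale (c p) (b p)" and ?v = "\<Sum>p\<in>J. cscale (c p) (b p)"
    have p: "b p \<in> V"
      using bV insert.prems by blast
    then have u: "?u \<in> V"
      unfolding B by (rule coord.span_scale)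
    have v: "?v \<in> V" "f ?v = (\<Sum>p\<in>J. cscale (s (c p)) (f (b p)))"
      using insert.IH insert.prems by blast+
    have "?u + ?v \<in> V"
      using u v(1) unfolding B by (rule coord.span_add)
    moreover have "f (?u + ?v) = f ?u + f ?v"
      using add u v(1) by blast
    moreover have "f ?u = cscale (s (c p)) (f (b p))"
      using scale p by blast
    ultimately show ?case
      unfolding sum.insert[OF insert.hyps] v(2)[symmetric] by (simp only: simp_thms)
  qed
  define g where "g = (\<lambda>x\<in>?M. \<Sum>p\<in>I. cscale (x p) (f (b p)))"
  have closed: "x + y \<in> ?M" "cscale c x \<in> ?M" if "x \<in> ?M" "y \<in> ?M" for x y c
    using that unfolding base_change_def by (auto intro: coord.span_add coord.span_scale)
  have lin: "linear_on ?M g"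
    using closed unfolding linear_on_def g_def
    by (auto simp: fun_eq_iff sum_fun_eval cscale_def algebra_simps sum.distrib sum_distrib_left)
  have mem: "s \<circ> v \<in> ?M" if "v \<in> V" for v
    unfolding base_change_def using that by (intro coord.span_base) auto
  have ext: "g (s \<circ> v) = f v" if "v \<in> V" for v
  proof -
    have "g (s \<circ> v) = (\<Sum>p\<in>I. cscale (s (v p)) (f (b p)))"
      using mem[OF that] by (simp add: g_def)
    also have "\<dots> = f (\<Sum>p\<in>I. cscale (v p) (b p))"
      using fsum[of I v] by simp
    finally show ?thesis
      using exp[OF that] by simp
  qed
  have unique: "h = g" if h: "h \<in> extensional ?M" "linear_on ?M h" "\<forall>v\<in>V. h (s \<circ> v) = f v" for h
  proof (rule extensionalityI[OF h(1)])
    show "g \<in> extensional ?M"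
      by (simp add: g_def)
    fix x assume "x \<in> ?M"
    then have "x \<in> ?M \<and> h x = g x"
      unfolding base_change_def
    proof (induction rule: coord.span_induct_alt)
      case base
      have "s \<circ> 0 \<in> ?M" "h (s \<circ> 0) = g (s \<circ> 0)"
        using mem zero h(3) ext by auto
      moreover have "s 0 = 0"
        by (rule is_ring_hom_zero[OF s])
      then have "s \<circ> 0 = 0"
        by (simp add: fun_eq_iff)
      ultimately show ?case
        unfolding base_change_def[symmetric] by metis
    next
      case (step c x y)
      then obtain v where v: "v \<in> V" "x = s \<circ> v"
        by auto
      have x: "x \<in> ?M" "h x = g x"
        using v mem h(3) ext by auto
      have y: "y \<in> ?M" "h y = g y"
        using step.IH unfolding base_change_def by blast+
      have "h (cscale c x + y) = g (cscale c x + y)"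
        using h(2) lin x y closed[OF x(1) y(1)] unfolding linear_on_def by simp
      moreover have "cscale c x + y \<in> ?M"
        using closed x y by blast
      ultimately show ?case
        unfolding base_change_def by blast
    qed
    then show "h x = g x" by simp
  qed
  show ?thesis
  proof (rule ex1I[of _ g])
    show "g \<in> extensional ?M \<and> linear_on ?M g \<and> (\<forall>v\<in>V. g (s \<circ> v) = f v)"
      using lin ext by (simp add: g_def)
  qed (use unique in blast)
qed

lemma istopology_quotient:
  "istopology (\<lambda>U. U \<subseteq> q ` topspace T \<and> openin T {x \<in> topspace T. q x \<in> U})"
proof (unfold istopology_def, intro conjI allI impI)
  fix S S'
  assume "S \<subseteq> q ` topspace T \<and> openin T {x \<in> topspace T. q x \<in> S}"
    and "S' \<subseteq> q ` topspace T \<and> openin T {x \<in> topspace T. q x \<in> S'}"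
  moreover have "{x \<in> topspace T. q x \<in> S \<inter> S'}
      = {x \<in> topspace T. q x \<in> S} \<inter> {x \<in> topspace T. q x \<in> S'}"
    by blast
  ultimately show "S \<inter> S' \<subseteq> q ` topspace T" "openin T {x \<in> topspace T. q x \<in> S \<inter> S'}"
    by auto
next
  fix \<K>
  assume *: "\<forall>K\<in>\<K>. K \<subseteq> q ` topspace T \<and> openin T {x \<in> topspace T. q x \<in> K}"
  then show "\<Union>\<K> \<subseteq> q ` topspace T"
    by blast
  have "{x \<in> topspace T. q x \<in> \<Union>\<K>} = \<Union>((\<lambda>K. {x \<in> topspace T. q x \<in> K}) ` \<K>)"
    by blast
  with * show "openin T {x \<in> topspace T. q x \<in> \<Union>\<K>}"
    by auto
qed

lemma openin_quotient_topology:
  "openin (quotient_topology T q) U \<longleftrightarrow>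
    U \<subseteq> q ` topspace T \<and> openin T {x \<in> topspace T. q x \<in> U}"
  unfolding quotient_topology_def by (simp add: topology_inverse'[OF istopology_quotient])

lemma topspace_quotient_topology: "topspace (quotient_topology T q) = q ` topspace T"
proof -
  have "{x \<in> topspace T. q x \<in> q ` topspace T} = topspace T"
    by blast
  then have "openin (quotient_topology T q) (q ` topspace T)"
    by (simp add: openin_quotient_topology)
  then show ?thesis
    by (metis openin_quotient_topology openin_subset openin_topspace subset_antisym)
qed

lemma quotient_map_quotient_topology: "quotient_map T (quotient_topology T q) q"
  by (auto simp: quotient_map_def openin_quotient_topology topspace_quotient_topology)

lemma KS_retraction_orbit:
  "KS_retraction (galois_orbit F \<psi>) = galois_orbit F (unitarize \<psi>)"
proof -
  have *: "unitarize (\<psi> \<circ> \<gamma>) = unitarize \<psi> \<circ> \<gamma>" if "\<gamma> \<in> galois_group F" for \<gamma>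
  proof -
    have bij: "bij \<gamma>"
      using that by (simp add: galois_group_def ring_iso_def ring_of_type_algebra_def)
    have "\<gamma> 0 = 0"
      using that by (intro is_ring_hom_zero) (simp add: galois_group_def ring_iso_def)
    then have "\<gamma> a = 0 \<longleftrightarrow> a = 0" for a
      using bij by (metis bij_pointE)
    then show ?thesis
      by (auto simp: unitarize_def fun_eq_iff)
  qed
  show ?thesis
    unfolding KS_retraction_def galois_orbit_def by (auto simp: * image_iff) (use * in metis)
qed

end

theory Submission
  imports Defs
begin

text \<open>
  The space \<open>KS_space\<close> deformation retracts onto \<open>KS_compact_space\<close>: the homotopy
  \<open>\<psi> \<mapsto> \<psi> |\<psi>|\<^sup>-\<^sup>t\<close> keeps the values at roots of unity, since these lie on the unit
  circle, commutes with the Galois action, fixes unitary characters, and ends at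
  \<open>\<psi> / |\<psi>|\<close>.  It descends to the orbit spaces because the product of a quotient map with
  the compact unit interval is a quotient map (\<open>continuous_map_KS_homotopy\<close>).

  The Tannakian dual of local systems is invariant under such a retraction \<open>r\<close> with section
  \<open>i\<close> (\<open>tannaka_map_iso_of_deformation_retraction\<close>).  Parallel transport along the homotopy is a
  morphism of local systems from \<open>E\<close> to \<open>r\<^sup>* i\<^sup>* E\<close>.  It is obtained from two properties of
  the etale space of a local system: lifts to it are locally constant in a trivialization, so they
  exist over short time intervals, and two lifts that agree at a point agree nearby, so they can be
  concatenated and are determined by their initial value.

  Different local systems with the same stalks, such as \<open>f\<^sup>*(E \<otimes> E')\<close> and
  \<open>f\<^sup>* E \<otimes> f\<^sup>* E'\<close>, or \<open>E\<close> and \<open>r\<^sup>* i\<^sup>* E\<close> at a point fixed by the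
  homotopy, are compared by naturality (\<open>tensor_automorphism_eq\<close>): a tensor automorphism takes the
  same value at two local systems linked by a single morphism that is the identity on the stalk at
  the base point.  With it, pullback along any continuous map transports tensor automorphisms, and
  pullback along \<open>i\<close> inverts pullback along \<open>r\<close>.  For this argument pullbacks, units and tensor
  products have to be local systems again; the tensor product is trivialized by the fibrewise tensor
  product of trivializations.
\<close>

section \<open>Continuity is local\<close>

lemma continuous_map_locally:
  assumes "\<And>y. y \<in> topspace Y \<Longrightarrow> \<exists>N. openin Y N \<and> y \<in> N \<and> continuous_map (subtopology Y N) T f"
  shows "continuous_map Y T f"
  unfolding continuous_map_def
proof (intro conjI allI impI)
  show "f \<in> topspace Y \<rightarrow> topspace T"
  proof
    fix y assume y: "y \<in> topspace Y"
    from assms[OF y] obtain N where "y \<in> N" "continuous_map (subtopology Y N) T f" by blast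
    with y show "f y \<in> topspace T"
      by (auto simp: continuous_map_def)
  qed
  fix W assume W: "openin T W"
  show "openin Y {y \<in> topspace Y. f y \<in> W}"
  proof (subst openin_subopen, safe)
    fix y assume y: "y \<in> topspace Y" "f y \<in> W"
    from assms[OF y(1)] obtain N where N: "openin Y N" "y \<in> N" "continuous_map (subtopology Y N) T f"
      by blast
    from N(3) W have "openin (subtopology Y N) {z \<in> topspace (subtopology Y N). f z \<in> W}"
      by (rule openin_continuous_map_preimage)
    then have "openin Y {z \<in> topspace (subtopology Y N). f z \<in> W}"
      using N(1) openin_trans_full by blast
    then show "\<exists>T. openin Y T \<and> y \<in> T \<and> T \<subseteq> {y \<in> topspace Y. f y \<in> W}"
      using y N by (intro exI[of _ "{z \<in> topspace (subtopology Y N). f z \<in> W}"]) auto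
  qed
qed

section \<open>Local trivializations\<close>

lemma Loc_topspace: "E \<in> Loc Z \<Longrightarrow> topspace (etale E) = (SIGMA z:topspace Z. stalk E z)"
  and Loc_proj: "E \<in> Loc Z \<Longrightarrow> continuous_map (etale E) Z fst"
  and Loc_fd: "E \<in> Loc Z \<Longrightarrow> z \<in> topspace Z \<Longrightarrow> fd_subspace (stalk E z)"
  by (auto simp: Loc_def)

lemma Loc_trivialization:
  assumes "E \<in> Loc Z" "z \<in> topspace Z"
  obtains U V \<phi> where "openin Z U" "z \<in> U" "fd_subspace V" "local_trivialization Z E U V \<phi>"
  using assms by (auto simp: Loc_def)

lemma local_trivialization_linear:
  "local_trivialization Z E U V \<phi> \<Longrightarrow> u \<in> U \<Longrightarrow> linear_on V (\<phi> u)"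
  and local_trivialization_bij:
  "local_trivialization Z E U V \<phi> \<Longrightarrow> u \<in> U \<Longrightarrow> bij_betw (\<phi> u) V (stalk E u)"
  by (auto simp: local_trivialization_def)

lemma local_trivialization_continuous:
  assumes triv: "local_trivialization Z E U V \<phi>" and "v \<in> V"
  shows "continuous_map (subtopology Z U) (etale E) (\<lambda>u. (u, \<phi> u v))"
proof -
  have "continuous_map (prod_topology (subtopology Z U) (discrete_topology V))
      (etale E) (\<lambda>(u, v). (u, \<phi> u v))"
    using triv unfolding local_trivialization_def
    by (auto dest!: homeomorphic_imp_continuous_map simp: continuous_map_in_subtopology)
  moreover have "continuous_map (subtopology Z U)
      (prod_topology (subtopology Z U) (discrete_topology V)) (\<lambda>u. (u, v))"
    using \<open>v \<in> V\<close> by (auto simp: continuous_map_pairwise o_def)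
  ultimately show ?thesis
    using continuous_map_compose[of _ _ "\<lambda>u. (u, v)" _ "\<lambda>(u, v). (u, \<phi> u v)"] by (simp add: o_def)
qed

text \<open>The fibre of a trivialization is discrete, so each of its constant sections is an open map.\<close>

lemma local_trivialization_open:
  assumes E: "E \<in> Loc Z" and triv: "local_trivialization Z E U V \<phi>" and "openin Z U"
    and v: "v \<in> V" and N: "openin Z N" "N \<subseteq> U"
  shows "openin (etale E) ((\<lambda>u. (u, \<phi> u v)) ` N)"
proof -
  let ?S = "SIGMA u:U. stalk E u"
  have "?S = {e \<in> topspace (etale E). fst e \<in> U}"
    using Loc_topspace[OF E] openin_subset[OF \<open>openin Z U\<close>] by auto
  then have S: "openin (etale E) ?S"
    using openin_continuous_map_preimage[OF Loc_proj[OF E] \<open>openin Z U\<close>] by simp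
  have "openin (subtopology Z U) N"
    using N by (rule subset_openin_subtopology)
  then have "openin (prod_topology (subtopology Z U) (discrete_topology V)) (N \<times> {v})"
    using v by (simp add: openin_prod_Times_iff)
  moreover have "open_map (prod_topology (subtopology Z U) (discrete_topology V))
      (subtopology (etale E) ?S) (\<lambda>(u, v). (u, \<phi> u v))"
    using triv by (simp add: local_trivialization_def homeomorphic_imp_open_map)
  ultimately have "openin (subtopology (etale E) ?S) ((\<lambda>(u, v). (u, \<phi> u v)) ` (N \<times> {v}))"
    unfolding open_map_def by blast
  then have "openin (etale E) ((\<lambda>(u, v). (u, \<phi> u v)) ` (N \<times> {v}))"
    using S openin_trans_full by blast
  moreover have "(\<lambda>(u, v). (u, \<phi> u v)) ` (N \<times> {v}) = (\<lambda>u. (u, \<phi> u v)) ` N"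
    by auto
  ultimately show ?thesis by simp
qed

text \<open>Because the fibre is discrete, whether a family of linear bijections is a homeomorphism onto
  the etale space can be decided one vector at a time: each constant section has to be continuous
  and open.  Pullbacks and tensor products are trivialized through this criterion.\<close>

lemma local_trivializationI:
  assumes U: "openin Z U"
    and top: "topspace (etale E) = (SIGMA z:topspace Z. stalk E z)"
    and lin: "\<And>u. u \<in> U \<Longrightarrow> linear_on V (\<phi> u)"
    and bij: "\<And>u. u \<in> U \<Longrightarrow> bij_betw (\<phi> u) V (stalk E u)"
    and cont: "\<And>v. v \<in> V \<Longrightarrow> continuous_map (subtopology Z U) (etale E) (\<lambda>u. (u, \<phi> u v))"
    and opn: "\<And>v N. v \<in> V \<Longrightarrow> openin Z N \<Longrightarrow> N \<subseteq> U \<Longrightarrow> openin (etale E) ((\<lambda>u. (u, \<phi> u v)) ` N)"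
  shows "local_trivialization Z E U V \<phi>"
proof -
  let ?P = "prod_topology (subtopology Z U) (discrete_topology V)"
  let ?S = "SIGMA u:U. stalk E u"
  let ?h = "\<lambda>(u, v). (u, \<phi> u v)"
  have UZ: "U \<subseteq> topspace Z"
    using openin_subset[OF U] .
  have image: "?h ` (U \<times> V) = ?S"
    using bij by (fastforce simp: bij_betw_def image_iff)
  have "homeomorphic_map ?P (subtopology (etale E) ?S) ?h"
  proof (rule bijective_open_imp_homeomorphic_map)
    have "continuous_map ?P (etale E) ?h"
    proof (rule continuous_map_locally)
      fix y assume "y \<in> topspace ?P"
      then obtain u v where y: "y = (u, v)" "u \<in> U" "v \<in> V" by auto
      have "continuous_map (subtopology ?P (U \<times> {v})) (etale E) ((\<lambda>u. (u, \<phi> u v)) \<circ> fst)"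
        using \<open>v \<in> V\<close> by (intro continuous_map_compose[OF _ cont] continuous_map_from_subtopology
            continuous_map_fst)
      then have "continuous_map (subtopology ?P (U \<times> {v})) (etale E) ?h"
        by (rule continuous_map_eq) auto
      moreover have "openin ?P (U \<times> {v})"
        using y U by (simp add: openin_prod_Times_iff openin_open_subtopology)
      ultimately show "\<exists>N. openin ?P N \<and> y \<in> N \<and> continuous_map (subtopology ?P N) (etale E) ?h"
        using y by blast
    qed
    then show "continuous_map ?P (subtopology (etale E) ?S) ?h"
      using image UZ by (auto simp: continuous_map_in_subtopology)
    show "open_map ?P (subtopology (etale E) ?S) ?h"
      unfolding open_map_def
    proof (intro allI impI)
      fix G assume G: "openin ?P G"
      have sl: "openin Z {u. (u, v) \<in> G}" "{u. (u, v) \<in> G} \<subseteq> U" "v \<in> V" if "(u, v) \<in> G" for u v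
      proof -
        have GU: "G \<subseteq> U \<times> V"
          using openin_subset[OF G] by auto
        then show v: "v \<in> V" and "{u. (u, v) \<in> G} \<subseteq> U"
          using that by auto
        have "continuous_map (subtopology Z U) ?P (\<lambda>u. (u, v))"
          using v by (auto simp: continuous_map_pairwise o_def)
        from openin_continuous_map_preimage[OF this G]
        have "openin Z {u \<in> topspace (subtopology Z U). (u, v) \<in> G}"
          using U openin_trans_full by blast
        moreover have "{u \<in> topspace (subtopology Z U). (u, v) \<in> G} = {u. (u, v) \<in> G}"
          using GU UZ by auto
        ultimately show "openin Z {u. (u, v) \<in> G}" by simp
      qed
      have "?h ` G = (\<Union>(u,v)\<in>G. (\<lambda>u. (u, \<phi> u v)) ` {u. (u, v) \<in> G})"
          by (auto simp: image_iff)
      moreover have "openin (etale E) \<dots>"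
      proof (rule openin_Union)
        fix S assume "S \<in> (\<lambda>(u, v). (\<lambda>u. (u, \<phi> u v)) ` {u. (u, v) \<in> G}) ` G"
        then obtain u v where "(u, v) \<in> G" "S = (\<lambda>u. (u, \<phi> u v)) ` {u. (u, v) \<in> G}"
          by auto
        with sl[OF this(1)] opn show "openin (etale E) S"
          by simp
      qed
      ultimately have "openin (etale E) (?h ` G)" by simp
      moreover have "?h ` G \<subseteq> ?S"
        unfolding image[symmetric] using openin_subset[OF G] by (intro image_mono) auto
      ultimately show "openin (subtopology (etale E) ?S) (?h ` G)"
        by (rule subset_openin_subtopology)
    qed
    show "?h ` topspace ?P = topspace (subtopology (etale E) ?S)"
      using image UZ top by (auto simp: Int_absorb1)
    show "inj_on ?h (topspace ?P)"
    proof (rule inj_onI)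
      fix y y' assume *: "y \<in> topspace ?P" "y' \<in> topspace ?P" "?h y = ?h y'"
      obtain u v u' v' where y: "y = (u, v)" "y' = (u', v')" by fastforce
      with * have "u = u'" "u \<in> U" "v \<in> V" "v' \<in> V" "\<phi> u v = \<phi> u v'" by auto
      then show "y = y'"
        using bij_betw_imp_inj_on[OF bij[of u]] y by (auto dest: inj_onD)
    qed
  qed
  then show ?thesis
    using lin bij by (simp add: local_trivialization_def)
qed

section \<open>Lifts to the etale space\<close>

text \<open>Sections (\<open>p\<close> the identity), flat sections along a path \<open>p\<close>, and families of flat sections
  (\<open>p\<close> a homotopy) are all continuous lifts of some map \<open>p\<close> to the etale space, and are
  treated at once.\<close>

abbreviation lift_to_etale ::
  "('z, 'k::field) local_sys \<Rightarrow> 'y topology \<Rightarrow> ('y \<Rightarrow> 'z) \<Rightarrow> ('y \<Rightarrow> nat \<Rightarrow> 'k) \<Rightarrow> bool"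
  where "lift_to_etale E Y p a \<equiv> continuous_map Y (etale E) (\<lambda>y. (p y, a y))"

lemma lift_to_etale_base:
  assumes "E \<in> Loc Z" "lift_to_etale E Y p a"
  shows "continuous_map Y Z p"
  using continuous_map_compose[OF assms(2) Loc_proj[OF assms(1)]] by (simp add: o_def)

lemma lift_to_etale_stalk:
  assumes "E \<in> Loc Z" "lift_to_etale E Y p a" "y \<in> topspace Y"
  shows "p y \<in> topspace Z" "a y \<in> stalk E (p y)"
  using continuous_map_image_subset_topspace[OF assms(2)] assms(3) Loc_topspace[OF assms(1)] by auto

text \<open>The constant section of the trivialization through the point \<open>a y\<close> has an open image, and the
  lift stays in that image near \<open>y\<close>.\<close>

lemma lift_to_etale_locally_constant:
  assumes E: "E \<in> Loc Z" and triv: "local_trivialization Z E U V \<phi>" and U: "openin Z U"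
    and lift: "lift_to_etale E Y p a" and y: "y \<in> topspace Y" "p y \<in> U"
  obtains N v where "openin Y N" "y \<in> N" "v \<in> V"
    "\<forall>x\<in>N. p x \<in> U \<and> a x = \<phi> (p x) v"
proof -
  have "a y \<in> \<phi> (p y) ` V"
    using lift_to_etale_stalk(2)[OF E lift y(1)] local_trivialization_bij[OF triv y(2)]
    by (simp add: bij_betw_def)
  then obtain v where v: "v \<in> V" "a y = \<phi> (p y) v"
    by auto
  let ?N = "{x \<in> topspace Y. (p x, a x) \<in> (\<lambda>u. (u, \<phi> u v)) ` U}"
  have "openin Y ?N"
    using openin_continuous_map_preimage[OF lift local_trivialization_open[OF E triv U v(1) U]]
    by simp
  then show thesis
    using v y by (intro that[of ?N v]) auto
qed

lemma lift_to_etale_of_locally_constant: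
  assumes p: "continuous_map Y Z p"
    and loc: "\<And>y. y \<in> topspace Y \<Longrightarrow> \<exists>N U V \<phi> v. openin Y N \<and> y \<in> N \<and>
      local_trivialization Z E U V \<phi> \<and> v \<in> V \<and> (\<forall>x\<in>N. p x \<in> U \<and> a x = \<phi> (p x) v)"
  shows "lift_to_etale E Y p a"
proof (rule continuous_map_locally)
  fix y assume "y \<in> topspace Y"
  from loc[OF this] obtain N U V \<phi> v where *: "openin Y N" "y \<in> N"
    "local_trivialization Z E U V \<phi>" "v \<in> V" "\<forall>x\<in>N. p x \<in> U \<and> a x = \<phi> (p x) v"
    by metis
  have "continuous_map (subtopology Y N) (subtopology Z U) p"
    using *(5) p by (simp add: image_subset_iff continuous_map_in_subtopology continuous_map_from_subtopology)
  from continuous_map_compose[OF this local_trivialization_continuous[OF *(3,4)]]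
  have "lift_to_etale E (subtopology Y N) p a"
    by (rule continuous_map_eq) (simp add: *(5))
  with *(1,2) show "\<exists>N. openin Y N \<and> y \<in> N \<and> lift_to_etale E (subtopology Y N) p a"
    by blast
qed

text \<open>Any finite number of lifts are simultaneously constant near a point; two suffice here.\<close>

lemma lift_to_etale_locally_constant2:
  assumes E: "E \<in> Loc Z" and a: "lift_to_etale E Y p a" and b: "lift_to_etale E Y p b"
    and y: "y \<in> topspace Y"
  obtains N U V \<phi> v w where "openin Y N" "y \<in> N" "local_trivialization Z E U V \<phi>" "fd_subspace V"
    "v \<in> V" "w \<in> V" "\<forall>x\<in>N. p x \<in> U \<and> a x = \<phi> (p x) v \<and> b x = \<phi> (p x) w"
proof -
  obtain U V \<phi> where U: "openin Z U" "p y \<in> U" "fd_subspace V" "local_trivialization Z E U V \<phi>"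
    using Loc_trivialization[OF E lift_to_etale_stalk(1)[OF E a y]] .
  obtain N v where N: "openin Y N" "y \<in> N" "v \<in> V" "\<forall>x\<in>N. p x \<in> U \<and> a x = \<phi> (p x) v"
    using lift_to_etale_locally_constant[OF E U(4,1) a y U(2)] .
  obtain M w where M: "openin Y M" "y \<in> M" "w \<in> V" "\<forall>x\<in>M. p x \<in> U \<and> b x = \<phi> (p x) w"
    using lift_to_etale_locally_constant[OF E U(4,1) b y U(2)] .
  show thesis
  proof (rule that)
    show "openin Y (N \<inter> M)" "y \<in> N \<inter> M"
      using N(1,2) M(1,2) by auto
    show "\<forall>x\<in>N \<inter> M. p x \<in> U \<and> a x = \<phi> (p x) v \<and> b x = \<phi> (p x) w"
      using N(4) M(4) by blast
  qed (fact U(4) U(3) N(3) M(3))+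
qed

text \<open>In a trivialization two lifts become two locally constant functions, so the loci where they
  agree and where they differ are both open.  On a connected space this is uniqueness of the lift
  with given initial value.\<close>

lemma lift_to_etale_equalizer:
  assumes E: "E \<in> Loc Z" and a: "lift_to_etale E Y p a" and b: "lift_to_etale E Y p b"
  shows "openin Y {y \<in> topspace Y. a y = b y}" "openin Y {y \<in> topspace Y. a y \<noteq> b y}"
proof -
  have key: "\<exists>N. openin Y N \<and> y \<in> N \<and> (\<forall>x\<in>N. (a x = b x) = (a y = b y))"
    if y: "y \<in> topspace Y" for y
  proof -
    obtain N U V \<phi> v w where *: "openin Y N" "y \<in> N" "local_trivialization Z E U V \<phi>"
      "fd_subspace V" "v \<in> V" "w \<in> V" "\<forall>x\<in>N. p x \<in> U \<and> a x = \<phi> (p x) v \<and> b x = \<phi> (p x) w"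
      using lift_to_etale_locally_constant2[OF E a b y] .
    have "(a x = b x) = (v = w)" if "x \<in> N" for x
    proof -
      from *(7) that have x: "p x \<in> U" "a x = \<phi> (p x) v" "b x = \<phi> (p x) w"
        by blast+
      with bij_betw_imp_inj_on[OF local_trivialization_bij[OF *(3) x(1)]] *(5,6) show ?thesis
        by (simp add: inj_on_eq_iff)
    qed
    then have "(a x = b x) = (a y = b y)" if "x \<in> N" for x
      using that *(2) by simp
    with *(1,2) show ?thesis by blast
  qed
  show "openin Y {y \<in> topspace Y. a y = b y}"
  proof (subst openin_subopen, safe)
    fix y assume "y \<in> topspace Y" "a y = b y"
    with key[of y] obtain N where "openin Y N" "y \<in> N" "\<forall>x\<in>N. a x = b x" by auto
    then show "\<exists>T. openin Y T \<and> y \<in> T \<and> T \<subseteq> {y \<in> topspace Y. a y = b y}"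
      using openin_subset[of Y N] by (intro exI[of _ N]) auto
  qed
  show "openin Y {y \<in> topspace Y. a y \<noteq> b y}"
  proof (subst openin_subopen, safe)
    fix y assume "y \<in> topspace Y" "a y \<noteq> b y"
    with key[of y] obtain N where "openin Y N" "y \<in> N" "\<forall>x\<in>N. a x \<noteq> b x" by auto
    then show "\<exists>T. openin Y T \<and> y \<in> T \<and> T \<subseteq> {y \<in> topspace Y. a y \<noteq> b y}"
      using openin_subset[of Y N] by (intro exI[of _ N]) auto
  qed
qed

lemma fd_subspace_closed:
  assumes "fd_subspace V"
  shows "0 \<in> V" "u \<in> V \<Longrightarrow> v \<in> V \<Longrightarrow> u + v \<in> V" "u \<in> V \<Longrightarrow> cscale c u \<in> V"
  using assms unfolding fd_subspace_def
  by (auto intro: coord.span_zero coord.span_add coord.span_scale)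

lemma lift_to_etale_add:
  assumes E: "E \<in> Loc Z" and a: "lift_to_etale E Y p a" and b: "lift_to_etale E Y p b"
  shows "lift_to_etale E Y p (\<lambda>y. a y + b y)"
proof (rule lift_to_etale_of_locally_constant[OF lift_to_etale_base[OF E a]])
  fix y assume y: "y \<in> topspace Y"
  obtain N U V \<phi> v w where *: "openin Y N" "y \<in> N" "local_trivialization Z E U V \<phi>"
    "fd_subspace V" "v \<in> V" "w \<in> V" "\<forall>x\<in>N. p x \<in> U \<and> a x = \<phi> (p x) v \<and> b x = \<phi> (p x) w"
    using lift_to_etale_locally_constant2[OF E a b y] .
  have eq: "p x \<in> U \<and> a x + b x = \<phi> (p x) (v + w)" if "x \<in> N" for x
  proof -
    from *(7) that have x: "p x \<in> U" "a x = \<phi> (p x) v" "b x = \<phi> (p x) w"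
      by blast+
    with local_trivialization_linear[OF *(3) x(1)] *(5,6) show ?thesis
      by (simp add: linear_on_def)
  qed
  show "\<exists>N U V \<phi> v. openin Y N \<and> y \<in> N \<and> local_trivialization Z E U V \<phi> \<and> v \<in> V \<and>
      (\<forall>x\<in>N. p x \<in> U \<and> a x + b x = \<phi> (p x) v)"
  proof (intro exI conjI)
    show "v + w \<in> V"
      using fd_subspace_closed(2)[OF *(4-6)] .
    show "\<forall>x\<in>N. p x \<in> U \<and> a x + b x = \<phi> (p x) (v + w)"
      using eq by blast
  qed (fact *(1-3))+
qed

lemma lift_to_etale_scale:
  assumes E: "E \<in> Loc Z" and a: "lift_to_etale E Y p a"
  shows "lift_to_etale E Y p (\<lambda>y. cscale c (a y))"
proof (rule lift_to_etale_of_locally_constant[OF lift_to_etale_base[OF E a]])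
  fix y assume y: "y \<in> topspace Y"
  obtain N U V \<phi> v w where *: "openin Y N" "y \<in> N" "local_trivialization Z E U V \<phi>"
    "fd_subspace V" "v \<in> V" "w \<in> V" "\<forall>x\<in>N. p x \<in> U \<and> a x = \<phi> (p x) v \<and> a x = \<phi> (p x) w"
    using lift_to_etale_locally_constant2[OF E a a y] .
  have eq: "p x \<in> U \<and> cscale c (a x) = \<phi> (p x) (cscale c v)" if "x \<in> N" for x
  proof -
    from *(7) that have x: "p x \<in> U" "a x = \<phi> (p x) v"
      by blast+
    with local_trivialization_linear[OF *(3) x(1)] *(5) show ?thesis
      by (simp add: linear_on_def)
  qed
  show "\<exists>N U V \<phi> v. openin Y N \<and> y \<in> N \<and> local_trivialization Z E U V \<phi> \<and> v \<in> V \<and>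
      (\<forall>x\<in>N. p x \<in> U \<and> cscale c (a x) = \<phi> (p x) v)"
  proof (intro exI conjI)
    show "cscale c v \<in> V"
      using fd_subspace_closed(3)[OF *(4,5)] .
    show "\<forall>x\<in>N. p x \<in> U \<and> cscale c (a x) = \<phi> (p x) (cscale c v)"
      using eq by blast
  qed (fact *(1-3))+
qed

text \<open>Through every point of the etale space passes a section over a neighbourhood whose image
  is open.  So continuity on the etale space may be tested along sections.\<close>

lemma continuous_map_from_etale:
  assumes E: "E \<in> Loc Z"
    and along: "\<And>z v. z \<in> topspace Z \<Longrightarrow> v \<in> stalk E z \<Longrightarrow> \<exists>N \<sigma>. openin Z N \<and> z \<in> N \<and> \<sigma> z = v \<and>
      lift_to_etale E (subtopology Z N) (\<lambda>u. u) \<sigma> \<and>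
      continuous_map (subtopology Z N) T (\<lambda>u. f (u, \<sigma> u))"
  shows "continuous_map (etale E) T f"
proof (rule continuous_map_locally)
  fix e assume "e \<in> topspace (etale E)"
  then obtain z v where e: "e = (z, v)" "z \<in> topspace Z" "v \<in> stalk E z"
    using Loc_topspace[OF E] by auto
  obtain N \<sigma> where N: "openin Z N" "z \<in> N" "\<sigma> z = v" "lift_to_etale E (subtopology Z N) (\<lambda>u. u) \<sigma>"
    "continuous_map (subtopology Z N) T (\<lambda>u. f (u, \<sigma> u))"
    using along[OF e(2,3)] by blast
  obtain U V \<phi> where U: "openin Z U" "z \<in> U" "fd_subspace V" "local_trivialization Z E U V \<phi>"
    using Loc_trivialization[OF E e(2)] .
  have "z \<in> topspace (subtopology Z N)"
    using N e by simp
  from lift_to_etale_locally_constant[OF E U(4,1) N(4) this U(2)]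
  obtain M w where M: "openin (subtopology Z N) M" "z \<in> M" "w \<in> V" "\<forall>x\<in>M. x \<in> U \<and> \<sigma> x = \<phi> x w" .
  have MZ: "openin Z M"
    using M(1) N(1) openin_trans_full by blast
  have MN: "M \<subseteq> N"
    using openin_subset[OF M(1)] by auto
  let ?G = "(\<lambda>u. (u, \<phi> u w)) ` M"
  have "openin (etale E) ?G"
    using local_trivialization_open[OF E U(4,1) M(3) MZ] M(4) by blast
  moreover have "e \<in> ?G"
    using M(2,4) N(3) e(1) by force
  moreover have "continuous_map (subtopology (etale E) ?G) T f"
  proof -
    have "continuous_map (subtopology (etale E) ?G) (subtopology Z N) fst"
      using MN Loc_proj[OF E] by (auto simp: continuous_map_in_subtopology continuous_map_from_subtopology)
    from continuous_map_compose[OF this N(5)] show ?thesis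
    proof (rule continuous_map_eq)
      fix y assume "y \<in> topspace (subtopology (etale E) ?G)"
      then obtain u where "u \<in> M" "y = (u, \<phi> u w)" by auto
      then show "((\<lambda>u. f (u, \<sigma> u)) \<circ> fst) y = f y"
        using M(4) by simp
    qed
  qed
  ultimately show "\<exists>N. openin (etale E) N \<and> e \<in> N \<and> continuous_map (subtopology (etale E) N) T f"
    by blast
qed

section \<open>Pullback and unit\<close>

lemma stalk_pullback: "z \<in> topspace Z \<Longrightarrow> stalk (Loc_pullback Z f E) z = stalk E (f z)"
  by (simp add: Loc_pullback_def)

lemma etale_pullback_fst:
  assumes "continuous_map Z W f" and E: "E \<in> Loc W"
  shows "topspace (etale (Loc_pullback Z f E)) = (SIGMA z:topspace Z. stalk E (f z))"
    and "continuous_map (etale (Loc_pullback Z f E)) Z fst"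
    and "lift_to_etale E (etale (Loc_pullback Z f E)) (\<lambda>e. f (fst e)) snd"
proof -
  let ?A = "SIGMA z:topspace Z. stalk E (f z)"
  have f: "f z \<in> topspace W" if "z \<in> topspace Z" for z
    using assms(1) that by (auto simp: continuous_map_def)
  show "topspace (etale (Loc_pullback Z f E)) = ?A"
    using Loc_topspace[OF E] f by (auto simp: Loc_pullback_def topspace_pullback_topology)
  have "continuous_map (etale (Loc_pullback Z f E)) Z (fst \<circ> (\<lambda>(z, v). (z, (f z, v))))"
    unfolding Loc_pullback_def local_sys.simps by (rule continuous_map_pullback) (rule continuous_map_fst)
  then show "continuous_map (etale (Loc_pullback Z f E)) Z fst"
    by (simp add: o_def case_prod_unfold)
  have "continuous_map (etale (Loc_pullback Z f E)) (etale E) (snd \<circ> (\<lambda>(z, v). (z, (f z, v))))"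
    unfolding Loc_pullback_def local_sys.simps by (rule continuous_map_pullback) (rule continuous_map_snd)
  then show "lift_to_etale E (etale (Loc_pullback Z f E)) (\<lambda>e. f (fst e)) snd"
    by (simp add: o_def case_prod_unfold)
qed

text \<open>The etale space of a pullback is a fibre product, whose universal property produces lifts.\<close>

lemma lift_to_etale_pullbackI:
  assumes E: "E \<in> Loc W" and p: "continuous_map Y Z p" and a: "lift_to_etale E Y (\<lambda>y. f (p y)) a"
  shows "lift_to_etale (Loc_pullback Z f E) Y p a"
  unfolding Loc_pullback_def local_sys.simps
proof (rule continuous_map_pullback')
  show "continuous_map Y (prod_topology Z (etale E)) ((\<lambda>(z, v). (z, (f z, v))) \<circ> (\<lambda>y. (p y, a y)))"
    using p a by (simp add: continuous_map_pairwise o_def)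
  show "topspace Y \<subseteq> (\<lambda>y. (p y, a y)) -` (SIGMA z:topspace Z. stalk E (f z))"
    using continuous_map_image_subset_topspace[OF p] lift_to_etale_stalk(2)[OF E a] by auto
qed

lemma Loc_pullback_in_Loc:
  assumes f: "continuous_map Z W f" and E: "E \<in> Loc W"
  shows "Loc_pullback Z f E \<in> Loc Z"
proof -
  let ?P = "Loc_pullback Z f E"
  have top: "topspace (etale ?P) = (SIGMA z:topspace Z. stalk ?P z)"
    using etale_pullback_fst(1)[OF f E] by (auto simp: stalk_pullback)
  have fW: "f z \<in> topspace W" if "z \<in> topspace Z" for z
    using f that by (auto simp: continuous_map_def)
  have "\<exists>U V \<phi>. openin Z U \<and> z \<in> U \<and> fd_subspace V \<and> local_trivialization Z ?P U V \<phi>"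
    if z: "z \<in> topspace Z" for z
  proof -
    obtain U V \<phi> where U: "openin W U" "f z \<in> U" "fd_subspace V" "local_trivialization W E U V \<phi>"
      using Loc_trivialization[OF E fW[OF z]] .
    let ?U = "{z \<in> topspace Z. f z \<in> U}"
    have oU: "openin Z ?U"
      using f U(1) by (rule openin_continuous_map_preimage)
    have "local_trivialization Z ?P ?U V (\<lambda>z. \<phi> (f z))"
    proof (rule local_trivializationI[OF oU top])
      show "linear_on V (\<phi> (f u))" "bij_betw (\<phi> (f u)) V (stalk ?P u)" if "u \<in> ?U" for u
        using local_trivialization_linear[OF U(4)] local_trivialization_bij[OF U(4)] that
        by (auto simp: stalk_pullback)
      fix v assume v: "v \<in> V"
      have fU: "continuous_map (subtopology Z ?U) (subtopology W U) f"
        using f by (auto simp: continuous_map_in_subtopology continuous_map_from_subtopology)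
      show "lift_to_etale ?P (subtopology Z ?U) (\<lambda>u. u) (\<lambda>u. \<phi> (f u) v)"
      proof (rule lift_to_etale_pullbackI[OF E])
        show "continuous_map (subtopology Z ?U) Z (\<lambda>u. u)"
          by (simp add: continuous_map_from_subtopology)
        show "lift_to_etale E (subtopology Z ?U) f (\<lambda>u. \<phi> (f u) v)"
          using continuous_map_compose[OF fU local_trivialization_continuous[OF U(4) v]]
          by (simp add: o_def)
      qed
      fix N assume N: "openin Z N" "N \<subseteq> ?U"
      let ?G = "(\<lambda>u. (u, \<phi> u v)) ` U"
      have "openin (etale E) ?G"
        using local_trivialization_open[OF E U(4,1) v U(1)] by simp
      then have "openin (etale ?P) ({e \<in> topspace (etale ?P). fst e \<in> N}
          \<inter> {e \<in> topspace (etale ?P). (f (fst e), snd e) \<in> ?G})"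
        using N(1) etale_pullback_fst(2,3)[OF f E]
        by (intro openin_Int openin_continuous_map_preimage)
      moreover have "(\<lambda>u. (u, \<phi> (f u) v)) ` N = {e \<in> topspace (etale ?P). fst e \<in> N}
          \<inter> {e \<in> topspace (etale ?P). (f (fst e), snd e) \<in> ?G}"
        using N(2) v local_trivialization_bij[OF U(4)] unfolding etale_pullback_fst(1)[OF f E]
        by (auto simp: bij_betw_def)
      ultimately show "openin (etale ?P) ((\<lambda>u. (u, \<phi> (f u) v)) ` N)"
        by simp
    qed
    then show ?thesis
      using oU U(2,3) z by (intro exI[of _ ?U] exI[of _ V] exI[of _ "\<lambda>z. \<phi> (f z)"]) simp
  qed
  moreover have "stalk ?P z = {}" if "z \<notin> topspace Z" for z
    using that by (simp add: Loc_pullback_def)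
  ultimately show ?thesis
    using top etale_pullback_fst(2)[OF f E] Loc_fd[OF E fW]
    unfolding Loc_def by (simp add: stalk_pullback)
qed

lemma fd_unit_space: "fd_subspace (unit_space :: (nat \<Rightarrow> 'k::field) set)"
  unfolding fd_subspace_def
proof (intro exI conjI)
  let ?e = "\<lambda>i::nat. if i = 0 then 1 else 0 :: 'k"
  show "unit_space = coord.span {?e}"
  proof (intro Set.set_eqI iffI)
    fix v :: "nat \<Rightarrow> 'k" assume "v \<in> unit_space"
    then have "v = cscale (v 0) ?e"
      by (auto simp: unit_space_def cscale_def fun_eq_iff)
    then show "v \<in> coord.span {?e}"
      by (metis coord.span_base coord.span_scale singletonI)
  next
    fix v :: "nat \<Rightarrow> 'k" assume "v \<in> coord.span {?e}"
    then show "v \<in> unit_space"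
      by (auto simp: coord.span_singleton unit_space_def cscale_def)
  qed
qed simp

lemma Loc_unit_in_Loc: "(Loc_unit Z :: ('z, 'k::field) local_sys) \<in> Loc Z"
proof -
  let ?E = "Loc_unit Z :: ('z, 'k) local_sys"
  have top: "topspace (etale ?E) = (SIGMA z:topspace Z. stalk ?E z)"
    by (auto simp: Loc_unit_def)
  have "local_trivialization Z ?E (topspace Z) unit_space (\<lambda>u v. v)"
  proof (rule local_trivializationI[OF openin_topspace top])
    fix v :: "nat \<Rightarrow> 'k" assume v: "v \<in> unit_space"
    show "lift_to_etale ?E (subtopology Z (topspace Z)) (\<lambda>u. u) (\<lambda>u. v)"
      using v by (simp add: Loc_unit_def continuous_map_pairwise o_def)
    fix N assume "openin Z N"
    then have "openin (etale ?E) (N \<times> {v})"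
      using v by (simp add: Loc_unit_def openin_prod_Times_iff)
    moreover have "N \<times> {v} = (\<lambda>u. (u, v)) ` N"
      by auto
    ultimately show "openin (etale ?E) ((\<lambda>u. (u, v)) ` N)"
      by simp
  qed (auto simp: linear_on_def Loc_unit_def bij_betw_def)
  then have "\<forall>z\<in>topspace Z. \<exists>U V \<phi>. openin Z U \<and> z \<in> U \<and> fd_subspace V \<and>
      local_trivialization Z ?E U V \<phi>"
    using fd_unit_space openin_topspace by (intro ballI exI conjI)
  moreover have "\<forall>z. z \<notin> topspace Z \<longrightarrow> stalk ?E z = {}" "\<forall>z\<in>topspace Z. fd_subspace (stalk ?E z)"
    by (simp_all add: Loc_unit_def fd_unit_space)
  moreover have "continuous_map (etale ?E) Z fst"
    by (simp add: Loc_unit_def continuous_map_fst)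
  ultimately show ?thesis
    using top unfolding Loc_def by (intro CollectI conjI)
qed

section \<open>Naturality\<close>

lemma Loc_homI:
  assumes "\<And>z. z \<in> topspace Z \<Longrightarrow> linear_on (stalk E z) (\<phi> z)"
    and "\<And>z. z \<in> topspace Z \<Longrightarrow> \<phi> z ` stalk E z \<subseteq> stalk E' z"
    and "lift_to_etale E' (etale E) fst (\<lambda>e. \<phi> (fst e) (snd e))"
  shows "\<phi> \<in> Loc_hom Z E E'"
  using assms by (simp add: Loc_hom_def case_prod_unfold)

lemma Loc_hom_pullback:
  assumes f: "continuous_map Z W f" and E: "E \<in> Loc W" and E': "E' \<in> Loc W" and \<phi>: "\<phi> \<in> Loc_hom W E E'"
  shows "(\<lambda>z. \<phi> (f z)) \<in> Loc_hom Z (Loc_pullback Z f E) (Loc_pullback Z f E')"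
proof (rule Loc_homI)
  fix z assume z: "z \<in> topspace Z"
  then have "f z \<in> topspace W"
    using f by (auto simp: continuous_map_def)
  then show "linear_on (stalk (Loc_pullback Z f E) z) (\<phi> (f z))"
    "\<phi> (f z) ` stalk (Loc_pullback Z f E) z \<subseteq> stalk (Loc_pullback Z f E') z"
    using \<phi> z by (simp_all add: Loc_hom_def stalk_pullback)
next
  have "continuous_map (etale E) (etale E') (\<lambda>(z, v). (z, \<phi> z v))"
    using \<phi> by (simp add: Loc_hom_def)
  from continuous_map_compose[OF etale_pullback_fst(3)[OF f E] this]
  show "lift_to_etale (Loc_pullback Z f E') (etale (Loc_pullback Z f E)) fst
      (\<lambda>e. \<phi> (f (fst e)) (snd e))"
    by (intro lift_to_etale_pullbackI[OF E' etale_pullback_fst(2)[OF f E]]) (simp add: o_def)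
qed

lemma extend_scalars_cong:
  "(\<And>v. v \<in> V \<Longrightarrow> f v = f' v) \<Longrightarrow> extend_scalars s V f = extend_scalars s V f'"
  by (simp add: extend_scalars_def cong: ball_cong)

lemma extend_scalars_pure:
  assumes s: "is_ring_hom s" and V: "fd_subspace V" and x: "x \<in> base_change s V"
  shows "extend_scalars s V (\<lambda>v. s \<circ> v) x = x"
proof -
  let ?M = "base_change s V"
  have hom: "s (a + b) = s a + s b" "s (a * b) = s a * s b" for a b
    using s by (auto simp: ring_hom_def ring_of_type_algebra_def)
  have ex1: "\<exists>!g. g \<in> extensional ?M \<and> linear_on ?M g \<and> (\<forall>v\<in>V. g (s \<circ> v) = s \<circ> v)"
    by (rule ex1_linear_extension[OF s V]) (auto simp: fun_eq_iff hom cscale_def)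
  have mem: "(\<lambda>x\<in>?M. x) \<in> extensional ?M \<and> linear_on ?M (\<lambda>x\<in>?M. x) \<and>
      (\<forall>v\<in>V. (\<lambda>x\<in>?M. x) (s \<circ> v) = s \<circ> v)"
    unfolding base_change_def
    by (auto simp: linear_on_def coord.span_add coord.span_scale coord.span_base)
  have "extend_scalars s V (\<lambda>v. s \<circ> v) = (\<lambda>x\<in>?M. x)"
    unfolding extend_scalars_def by (rule the1_equality[OF ex1, OF mem])
  with x show ?thesis by simp
qed

text \<open>Local systems that are isomorphic but not equal are compared through this lemma: a
  morphism that is the identity on the stalk at the base point, invertible or not, is invisible to
  tensor automorphisms.\<close>

lemma tensor_automorphism_eq:
  assumes s: "is_ring_hom s" and \<alpha>: "\<alpha> \<in> tensor_automorphisms Z z s"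
    and E: "E \<in> Loc Z" and E': "E' \<in> Loc Z" and z: "z \<in> topspace Z"
    and \<phi>: "\<phi> \<in> Loc_hom Z E E'" and st: "stalk E z = stalk E' z"
    and id: "\<And>v. v \<in> stalk E z \<Longrightarrow> \<phi> z v = v"
  shows "\<alpha> E = \<alpha> E'"
proof (rule extensionalityI[of _ "base_change s (stalk E z)"])
  let ?M = "base_change s (stalk E z)"
  have *: "\<alpha> E \<in> extensional ?M" "\<alpha> E' \<in> extensional ?M" "bij_betw (\<alpha> E) ?M ?M"
    "\<And>x. x \<in> ?M \<Longrightarrow> \<alpha> E' (extend_scalars s (stalk E z) (\<lambda>v. s \<circ> \<phi> z v) x)
        = extend_scalars s (stalk E z) (\<lambda>v. s \<circ> \<phi> z v) (\<alpha> E x)"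
    using \<alpha> E E' \<phi> st by (auto simp: tensor_automorphisms_def)
  then show "\<alpha> E \<in> extensional ?M" "\<alpha> E' \<in> extensional ?M"
    by blast+
  have id': "extend_scalars s (stalk E z) (\<lambda>v. s \<circ> \<phi> z v) x = x" if "x \<in> ?M" for x
  proof -
    have "extend_scalars s (stalk E z) (\<lambda>v. s \<circ> \<phi> z v) = extend_scalars s (stalk E z) (\<lambda>v. s \<circ> v)"
      by (rule extend_scalars_cong) (simp add: id)
    then show ?thesis
      using extend_scalars_pure[OF s Loc_fd[OF E z] that] by simp
  qed
  show "\<alpha> E x = \<alpha> E' x" if "x \<in> ?M" for x
    using *(4)[OF that] id'[OF that] id'[of "\<alpha> E x"] bij_betwE[OF *(3)] that by auto
qed

section \<open>Tensor products of linear maps\<close>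

lemma fd_subspace_coordinates:
  assumes "fd_subspace (V :: (nat \<Rightarrow> 'k::field) set)"
  obtains I b where "finite I" "\<forall>p\<in>I. b p \<in> V" "\<forall>v\<in>V. v = (\<Sum>p\<in>I. cscale (v p) (b p))"
  using fd_subspace_echelon[OF assms] by metis

lemma linear_on_zero:
  assumes V: "fd_subspace V" and f: "linear_on V f"
  shows "f 0 = 0"
proof -
  have "f (0 + 0) = f 0 + f 0"
    using f fd_subspace_closed(1)[OF V] unfolding linear_on_def by blast
  then show ?thesis by simp
qed

lemma linear_on_sum:
  assumes V: "fd_subspace V" and f: "linear_on V f" and x: "\<And>i. i \<in> I \<Longrightarrow> x i \<in> V" and "finite I"
  shows "f (\<Sum>i\<in>I. x i) = (\<Sum>i\<in>I. f (x i))"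
proof -
  note f0 = linear_on_zero[OF V f]
  have "(\<Sum>i\<in>I. x i) \<in> V \<and> f (\<Sum>i\<in>I. x i) = (\<Sum>i\<in>I. f (x i))"
    using \<open>finite I\<close> x
  proof (induction I rule: finite_induct)
    case empty
    then show ?case using f0 fd_subspace_closed(1)[OF V] by (simp only: sum.empty simp_thms)
  next
    case (insert i I)
    then have i: "x i \<in> V" and IH: "(\<Sum>i\<in>I. x i) \<in> V" "f (\<Sum>i\<in>I. x i) = (\<Sum>i\<in>I. f (x i))"
      by blast+
    have "f (x i + (\<Sum>i\<in>I. x i)) = f (x i) + f (\<Sum>i\<in>I. x i)"
      using f i IH(1) unfolding linear_on_def by blast
    with fd_subspace_closed(2)[OF V i IH(1)] IH(2) show ?case
      by (simp only: sum.insert[OF insert.hyps] simp_thms)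
  qed
  then show ?thesis ..
qed

lemma linear_on_compose:
  assumes "linear_on A f" "f ` A \<subseteq> B" "linear_on B g"
  shows "linear_on A (g \<circ> f)"
  using assms unfolding linear_on_def by (simp add: image_subset_iff)

lemma linear_on_the_inv_into:
  assumes V: "fd_subspace V" and f: "linear_on V f" and bij: "bij_betw f V S"
  shows "linear_on S (the_inv_into V f)"
proof -
  let ?g = "the_inv_into V f"
  have g: "?g x \<in> V" "f (?g x) = x" if "x \<in> S" for x
    using bij_betwE[OF bij_betw_the_inv_into[OF bij]] f_the_inv_into_f_bij_betw[OF bij] that by auto
  have eq: "?g (f v) = v" if "v \<in> V" for v
    using the_inv_into_f_f[OF bij_betw_imp_inj_on[OF bij] that] .
  have "?g (x + y) = ?g x + ?g y" if "x \<in> S" "y \<in> S" for x y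
  proof -
    have "f (?g x + ?g y) = x + y"
      using f g that unfolding linear_on_def by simp
    with eq[OF fd_subspace_closed(2)[OF V g(1)[OF that(1)] g(1)[OF that(2)]]] show ?thesis
      by simp
  qed
  moreover have "?g (cscale c x) = cscale c (?g x)" if "x \<in> S" for c x
  proof -
    have "f (cscale c (?g x)) = cscale c x"
      using f g that unfolding linear_on_def by simp
    with eq[OF fd_subspace_closed(3)[OF V g(1)[OF that]], of c] show ?thesis
      by simp
  qed
  ultimately show ?thesis
    by (simp add: linear_on_def)
qed

lemma tensor_vec_bilinear:
  "tensor_vec (u + u') v = tensor_vec u v + tensor_vec u' v"
  "tensor_vec u (v + v') = tensor_vec u v + tensor_vec u v'"
  "tensor_vec (cscale c u) v = cscale c (tensor_vec u v)"
  "tensor_vec u (cscale c v) = cscale c (tensor_vec u v)"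
  "tensor_vec (\<Sum>p\<in>I. x p) (\<Sum>q\<in>J. y q) = (\<Sum>p\<in>I. \<Sum>q\<in>J. tensor_vec (x p) (y q))"
  by (simp_all add: fun_eq_iff tensor_vec_def cscale_def algebra_simps sum_fun_eval sum_product)

lemma tensor_spaceI: "u \<in> V \<Longrightarrow> v \<in> W \<Longrightarrow> tensor_vec u v \<in> tensor_space V W"
  unfolding tensor_space_def by (rule coord.span_base) blast

lemma tensor_space_subspace: "coord.subspace (tensor_space V W)"
  unfolding tensor_space_def by (rule coord.subspace_span)

lemma fd_tensor_space:
  assumes "fd_subspace V" "fd_subspace W"
  shows "fd_subspace (tensor_space V W)"
proof -
  obtain I b where I: "finite I" "\<forall>p\<in>I. b p \<in> V"
    "\<forall>v\<in>V. v = (\<Sum>p\<in>I. cscale (v p) (b p))"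
    using fd_subspace_coordinates[OF assms(1)] .
  obtain J c where J: "finite J" "\<forall>p\<in>J. c p \<in> W"
    "\<forall>v\<in>W. v = (\<Sum>p\<in>J. cscale (v p) (c p))"
    using fd_subspace_coordinates[OF assms(2)] .
  let ?B = "(\<lambda>(p, q). tensor_vec (b p) (c q)) ` (I \<times> J)"
  have "tensor_vec u v \<in> coord.span ?B" if "u \<in> V" "v \<in> W" for u v
  proof -
    have "tensor_vec u v = tensor_vec (\<Sum>p\<in>I. cscale (u p) (b p)) (\<Sum>q\<in>J. cscale (v q) (c q))"
      by (rule arg_cong2[where f = tensor_vec, OF I(3)[rule_format, OF that(1)] J(3)[rule_format, OF that(2)]])
    also have "\<dots> = (\<Sum>p\<in>I. \<Sum>q\<in>J. cscale (v q) (cscale (u p) (tensor_vec (b p) (c q))))"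
      by (simp only: tensor_vec_bilinear)
    also have "\<dots> \<in> coord.span ?B"
      by (intro coord.span_sum coord.span_scale coord.span_base) auto
    finally show ?thesis .
  qed
  then have "tensor_space V W \<subseteq> coord.span ?B"
    unfolding tensor_space_def by (intro coord.span_minimal) (auto intro: coord.subspace_span)
  moreover have "coord.span ?B \<subseteq> tensor_space V W"
    using I(2) J(2) by (intro coord.span_minimal tensor_space_subspace) (auto intro: tensor_spaceI)
  ultimately show ?thesis
    unfolding fd_subspace_def using I(1) J(1) by (intro exI[of _ ?B]) auto
qed

text \<open>Scalars are absorbed into the left factor, which leaves sums of pure tensors, the form in which
  the topology of a tensor product of local systems is generated.\<close>

lemma tensor_space_sum:
  assumes V: "fd_subspace V" and t: "t \<in> tensor_space V W"
  obtains n :: nat and a b where "\<forall>i<n. a i \<in> V" "\<forall>i<n. b i \<in> W"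
    "t = (\<Sum>i<n. tensor_vec (a i) (b i))"
proof -
  have "\<exists>(n::nat) a b. (\<forall>i<n. a i \<in> V \<and> b i \<in> W) \<and> t = (\<Sum>i<n. tensor_vec (a i) (b i))"
    using t unfolding tensor_space_def
  proof (induction rule: coord.span_induct_alt)
    case base
    show ?case
      by (rule exI[of _ 0]) simp
  next
    case (step c x y)
    then obtain u v n a b where x: "x = tensor_vec u v" "u \<in> V" "v \<in> W"
      and ab: "\<forall>i<n. a i \<in> V \<and> b i \<in> W" "y = (\<Sum>i<n::nat. tensor_vec (a i) (b i))"
      by auto
    let ?a = "a(n := cscale c u)" and ?b = "b(n := v)"
    have "cscale c x + y = (\<Sum>i<Suc n. tensor_vec (?a i) (?b i))"
      by (simp add: x(1) ab(2) tensor_vec_bilinear add.commute)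
    moreover have "\<forall>i<Suc n. ?a i \<in> V \<and> ?b i \<in> W"
      using ab(1) x(2,3) fd_subspace_closed(3)[OF V] by (auto simp: less_Suc_eq)
    ultimately show ?case by blast
  qed
  then show thesis
    using that by blast
qed

lemma tensor_space_linear_eq:
  assumes V: "fd_subspace V" "fd_subspace W"
    and f: "linear_on (tensor_space V W) f" and g: "linear_on (tensor_space V W) g"
    and eq: "\<And>u v. u \<in> V \<Longrightarrow> v \<in> W \<Longrightarrow> f (tensor_vec u v) = g (tensor_vec u v)"
    and t: "t \<in> tensor_space V W"
  shows "f t = g t"
proof -
  obtain n :: nat and a b where ab: "\<forall>i<n. a i \<in> V" "\<forall>i<n. b i \<in> W"
    "t = (\<Sum>i<n. tensor_vec (a i) (b i))"
    using tensor_space_sum[OF V(1) t] .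
  have sum: "h t = (\<Sum>i<n. h (tensor_vec (a i) (b i)))" if "linear_on (tensor_space V W) h" for h
    unfolding ab(3) using ab(1,2)
    by (intro linear_on_sum[OF fd_tensor_space[OF V] that]) (auto intro: tensor_spaceI)
  show ?thesis
    unfolding sum[OF f] sum[OF g] using ab(1,2) by (intro sum.cong refl eq) auto
qed

text \<open>In the echelon bases \<open>b\<close>, \<open>c\<close> the coefficient of \<open>t\<close> at \<open>b\<^sub>p \<otimes> c\<^sub>q\<close> is the coordinate
  \<open>t (prod_encode (p, q))\<close>, so the tensor product of two linear maps has an explicit formula.\<close>

lemma ex_tensor_map:
  assumes V: "fd_subspace V" and W: "fd_subspace W" and f: "linear_on V f" and g: "linear_on W g"
  shows "\<exists>T. linear_on (tensor_space V W) T \<and>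
    (\<forall>u\<in>V. \<forall>v\<in>W. T (tensor_vec u v) = tensor_vec (f u) (g v))"
proof -
  obtain I b where I: "finite I" "\<forall>p\<in>I. b p \<in> V"
    "\<forall>v\<in>V. v = (\<Sum>p\<in>I. cscale (v p) (b p))"
    using fd_subspace_coordinates[OF V] .
  obtain J c where J: "finite J" "\<forall>p\<in>J. c p \<in> W"
    "\<forall>v\<in>W. v = (\<Sum>p\<in>J. cscale (v p) (c p))"
    using fd_subspace_coordinates[OF W] .
  define T where "T t = (\<Sum>p\<in>I. \<Sum>q\<in>J.
      cscale (t (prod_encode (p, q))) (tensor_vec (f (b p)) (g (c q))))" for t
  have fexp: "f u = (\<Sum>p\<in>I. cscale (u p) (f (b p)))" if "u \<in> V" for u
  proof -
    have "f u = f (\<Sum>p\<in>I. cscale (u p) (b p))"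
      using I(3)[rule_format, OF that] by simp
    also have "\<dots> = (\<Sum>p\<in>I. f (cscale (u p) (b p)))"
      using I(1,2) fd_subspace_closed(3)[OF V] by (intro linear_on_sum[OF V f]) auto
    also have "\<dots> = (\<Sum>p\<in>I. cscale (u p) (f (b p)))"
      using f I(2) by (intro sum.cong refl) (simp add: linear_on_def)
    finally show ?thesis .
  qed
  have gexp: "g u = (\<Sum>p\<in>J. cscale (u p) (g (c p)))" if "u \<in> W" for u
  proof -
    have "g u = g (\<Sum>p\<in>J. cscale (u p) (c p))"
      using J(3)[rule_format, OF that] by simp
    also have "\<dots> = (\<Sum>p\<in>J. g (cscale (u p) (c p)))"
      using J(1,2) fd_subspace_closed(3)[OF W] by (intro linear_on_sum[OF W g]) auto
    also have "\<dots> = (\<Sum>p\<in>J. cscale (u p) (g (c p)))"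
      using g J(2) by (intro sum.cong refl) (simp add: linear_on_def)
    finally show ?thesis .
  qed
  have "linear_on (tensor_space V W) T"
    by (simp add: linear_on_def T_def fun_eq_iff sum_fun_eval cscale_def algebra_simps sum.distrib
        sum_distrib_left)
  moreover have "T (tensor_vec u v) = tensor_vec (f u) (g v)" if "u \<in> V" "v \<in> W" for u v
    unfolding fexp[OF that(1)] gexp[OF that(2)] tensor_vec_bilinear(5) T_def
    by (simp add: fun_eq_iff tensor_vec_def cscale_def sum_fun_eval ac_simps)
  ultimately show ?thesis by blast
qed

lemma tensor_map_into:
  assumes V: "fd_subspace V" and W: "fd_subspace W" and T: "linear_on (tensor_space V W) T"
    and pure: "\<forall>u\<in>V. \<forall>v\<in>W. T (tensor_vec u v) = tensor_vec (f u) (g v)"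
    and f: "f ` V \<subseteq> S" and g: "g ` W \<subseteq> S'"
  shows "T ` tensor_space V W \<subseteq> tensor_space S S'"
proof
  fix y assume "y \<in> T ` tensor_space V W"
  then obtain t where t: "t \<in> tensor_space V W" "y = T t" by auto
  obtain n :: nat and a b where ab: "\<forall>i<n. a i \<in> V" "\<forall>i<n. b i \<in> W"
    "t = (\<Sum>i<n. tensor_vec (a i) (b i))"
    using tensor_space_sum[OF V t(1)] .
  have "y = (\<Sum>i<n. T (tensor_vec (a i) (b i)))"
    unfolding t(2) ab(3) using ab(1,2)
    by (intro linear_on_sum[OF fd_tensor_space[OF V W] T]) (auto intro: tensor_spaceI)
  also have "\<dots> \<in> tensor_space S S'"
  proof (rule coord.subspace_sum[OF tensor_space_subspace])
    fix i assume "i \<in> {..<n}"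
    with ab(1,2) have "a i \<in> V" "b i \<in> W" by auto
    with pure f g show "T (tensor_vec (a i) (b i)) \<in> tensor_space S S'"
      by (auto intro!: tensor_spaceI)
  qed
  finally show "y \<in> tensor_space S S'" .
qed

text \<open>The inverse is the tensor product of the inverses.\<close>

lemma bij_betw_tensor_map:
  assumes V: "fd_subspace V" and W: "fd_subspace W" and S: "fd_subspace S" and S': "fd_subspace S'"
    and f: "linear_on V f" "bij_betw f V S" and g: "linear_on W g" "bij_betw g W S'"
    and T: "linear_on (tensor_space V W) T"
    and pure: "\<forall>u\<in>V. \<forall>v\<in>W. T (tensor_vec u v) = tensor_vec (f u) (g v)"
  shows "bij_betw T (tensor_space V W) (tensor_space S S')"
proof -
  let ?f = "the_inv_into V f" and ?g = "the_inv_into W g"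
  obtain T' where T': "linear_on (tensor_space S S') T'"
    and pure': "\<forall>u\<in>S. \<forall>v\<in>S'. T' (tensor_vec u v) = tensor_vec (?f u) (?g v)"
    using ex_tensor_map[OF S S' linear_on_the_inv_into[OF V f] linear_on_the_inv_into[OF W g]]
    by (elim exE conjE)
  have inv: "f u \<in> S" "?f (f u) = u" if "u \<in> V" for u
    using that bij_betwE[OF f(2)] the_inv_into_f_f[OF bij_betw_imp_inj_on[OF f(2)]] by auto
  have inv': "?f u \<in> V" "f (?f u) = u" if "u \<in> S" for u
    using that bij_betwE[OF bij_betw_the_inv_into[OF f(2)]] f_the_inv_into_f_bij_betw[OF f(2)] by auto
  have ginv: "g u \<in> S'" "?g (g u) = u" if "u \<in> W" for u
    using that bij_betwE[OF g(2)] the_inv_into_f_f[OF bij_betw_imp_inj_on[OF g(2)]] by auto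
  have ginv': "?g u \<in> W" "g (?g u) = u" if "u \<in> S'" for u
    using that bij_betwE[OF bij_betw_the_inv_into[OF g(2)]] f_the_inv_into_f_bij_betw[OF g(2)] by auto
  have into: "T ` tensor_space V W \<subseteq> tensor_space S S'"
    using inv(1) ginv(1) by (intro tensor_map_into[OF V W T pure]) auto
  have into': "T' ` tensor_space S S' \<subseteq> tensor_space V W"
    using inv'(1) ginv'(1) by (intro tensor_map_into[OF S S' T' pure']) auto
  have lin_id: "linear_on A (\<lambda>t. t)" for A :: "(nat \<Rightarrow> 'a) set"
    by (simp add: linear_on_def)
  show ?thesis
  proof (rule bij_betw_byWitness[of _ T'])
    show "\<forall>t\<in>tensor_space V W. T' (T t) = t"
    proof
      fix t assume t: "t \<in> tensor_space V W"
      have "(T' \<circ> T) t = (\<lambda>t. t) t"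
        by (rule tensor_space_linear_eq[OF V W linear_on_compose[OF T into T'] lin_id _ t])
          (simp add: pure pure' inv ginv)
      then show "T' (T t) = t" by simp
    qed
    show "\<forall>t\<in>tensor_space S S'. T (T' t) = t"
    proof
      fix t assume t: "t \<in> tensor_space S S'"
      have "(T \<circ> T') t = (\<lambda>t. t) t"
        by (rule tensor_space_linear_eq[OF S S' linear_on_compose[OF T' into' T] lin_id _ t])
          (simp add: pure pure' inv' ginv')
      then show "T (T' t) = t" by simp
    qed
  qed (fact into into')+
qed

section \<open>Tensor products of local systems\<close>

lemma openin_tensor_sections:
  assumes "openin Z U" "\<forall>i<n::nat. \<sigma> i \<in> sections_over Z E U \<and> \<tau> i \<in> sections_over Z E' U"
  shows "openin (etale (Loc_tensor Z E E')) ((\<lambda>z. (z, \<Sum>i<n. tensor_vec (\<sigma> i z) (\<tau> i z))) ` U)"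
  unfolding Loc_tensor_def local_sys.simps
  by (rule topology_generated_by_Basis) (use assms in blast)

lemma stalk_tensor: "z \<in> topspace Z \<Longrightarrow> stalk (Loc_tensor Z E E') z = tensor_space (stalk E z) (stalk E' z)"
  by (simp add: Loc_tensor_def)

lemma continuous_map_into_tensor:
  assumes "\<And>U (n::nat) \<sigma> \<tau>. openin Z U \<Longrightarrow>
      \<forall>i<n. \<sigma> i \<in> sections_over Z E U \<and> \<tau> i \<in> sections_over Z E' U \<Longrightarrow>
      openin Y {y \<in> topspace Y. h y \<in> (\<lambda>z. (z, \<Sum>i<n. tensor_vec (\<sigma> i z) (\<tau> i z))) ` U}"
    and "h ` topspace Y \<subseteq> topspace (etale (Loc_tensor Z E E'))"
  shows "continuous_map Y (etale (Loc_tensor Z E E')) h"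
  unfolding Loc_tensor_def local_sys.simps
proof (rule continuous_on_generated_topo)
  show "h ` topspace Y \<subseteq> \<Union> {(\<lambda>z. (z, \<Sum>i<n. tensor_vec (\<sigma> i z) (\<tau> i z))) ` U |U (n::nat) \<sigma> \<tau>. openin Z U \<and>
      (\<forall>i<n. \<sigma> i \<in> sections_over Z E U \<and> \<tau> i \<in> sections_over Z E' U)}"
    using assms(2) unfolding Loc_tensor_def local_sys.simps topology_generated_by_topspace .
next
  fix G assume "G \<in> {(\<lambda>z. (z, \<Sum>i<n. tensor_vec (\<sigma> i z) (\<tau> i z))) ` U |U (n::nat) \<sigma> \<tau>. openin Z U \<and>
      (\<forall>i<n. \<sigma> i \<in> sections_over Z E U \<and> \<tau> i \<in> sections_over Z E' U)}"
  then obtain U n \<sigma> \<tau> where G: "G = (\<lambda>z. (z, \<Sum>i<n::nat. tensor_vec (\<sigma> i z) (\<tau> i z))) ` U" "openin Z U"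
    "\<forall>i<n. \<sigma> i \<in> sections_over Z E U \<and> \<tau> i \<in> sections_over Z E' U"
    by (elim CollectE exE conjE)
  have "h -` G \<inter> topspace Y = {y \<in> topspace Y. h y \<in> G}"
    by auto
  with assms(1)[OF G(2,3)] G(1) show "openin Y (h -` G \<inter> topspace Y)"
    by simp
qed

lemma sections_over_stalk:
  assumes "E \<in> Loc Z" "\<sigma> \<in> sections_over Z E U" "openin Z U" "z \<in> U"
  shows "\<sigma> z \<in> stalk E z"
  using lift_to_etale_stalk(2)[OF assms(1), of "subtopology Z U" "\<lambda>z. z" \<sigma> z] assms(2,4)
    openin_subset[OF assms(3)]
  by (auto simp: sections_over_def)

text \<open>Each section is constant in its trivialization near the point, and the tensor products of these
  constants add up to the constant \<open>t\<close>.\<close>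

lemma tensor_sections_locally_constant:
  assumes E: "E \<in> Loc Z" and E': "E' \<in> Loc Z"
    and U: "openin Z U" "fd_subspace V" "local_trivialization Z E U V \<phi>"
    and U': "openin Z U'" "fd_subspace V'" "local_trivialization Z E' U' V' \<psi>"
    and T: "\<And>u. u \<in> U \<inter> U' \<Longrightarrow> linear_on (tensor_space V V') (T u) \<and>
      (\<forall>a\<in>V. \<forall>b\<in>V'. T u (tensor_vec a b) = tensor_vec (\<phi> u a) (\<psi> u b))"
    and N: "openin Z N" "\<forall>i<n::nat. \<sigma> i \<in> sections_over Z E N \<and> \<tau> i \<in> sections_over Z E' N"
    and z: "z \<in> N" "z \<in> U" "z \<in> U'"
  shows "\<exists>M t. openin Z M \<and> z \<in> M \<and> M \<subseteq> N \<inter> (U \<inter> U') \<and> t \<in> tensor_space V V' \<and>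
    (\<forall>u\<in>M. (\<Sum>i<n. tensor_vec (\<sigma> i u) (\<tau> i u)) = T u t)"
  using N(2)
proof (induction n)
  case 0
  have "T u 0 = 0" if "u \<in> U \<inter> U'" for u
    using linear_on_zero[OF fd_tensor_space[OF U(2) U'(2)] conjunct1[OF T[OF that]]] .
  then have "\<forall>u\<in>N \<inter> (U \<inter> U'). (\<Sum>i<0. tensor_vec (\<sigma> i u) (\<tau> i u)) = T u 0"
    unfolding lessThan_0 sum.empty by (metis IntD2)
  moreover have "openin Z (N \<inter> (U \<inter> U'))" "z \<in> N \<inter> (U \<inter> U')"
    using N(1) U(1) U'(1) z by auto
  ultimately show ?case
    using coord.subspace_0[OF tensor_space_subspace] by blast
next
  case (Suc n)
  then obtain M t where M: "openin Z M" "z \<in> M" "M \<subseteq> N \<inter> (U \<inter> U')" "t \<in> tensor_space V V'"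
    "\<forall>u\<in>M. (\<Sum>i<n. tensor_vec (\<sigma> i u) (\<tau> i u)) = T u t"
    by auto
  have zN: "z \<in> topspace (subtopology Z N)"
    using z openin_subset[OF N(1)] by auto
  have lifts: "lift_to_etale E (subtopology Z N) (\<lambda>u. u) (\<sigma> n)"
    "lift_to_etale E' (subtopology Z N) (\<lambda>u. u) (\<tau> n)"
    using Suc.prems by (simp_all add: sections_over_def)
  obtain A a where A: "openin (subtopology Z N) A" "z \<in> A" "a \<in> V" "\<forall>x\<in>A. x \<in> U \<and> \<sigma> n x = \<phi> x a"
    using lift_to_etale_locally_constant[OF E U(3,1) lifts(1) zN z(2)] .
  obtain B b where B: "openin (subtopology Z N) B" "z \<in> B" "b \<in> V'" "\<forall>x\<in>B. x \<in> U' \<and> \<tau> n x = \<psi> x b"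
    using lift_to_etale_locally_constant[OF E' U'(3,1) lifts(2) zN z(3)] .
  define t' where "t' = t + tensor_vec a b"
  have AB: "openin Z A" "openin Z B"
    using A(1) B(1) N(1) openin_trans_full by blast+
  have ab: "tensor_vec a b \<in> tensor_space V V'"
    using A(3) B(3) by (rule tensor_spaceI)
  have "(\<Sum>i<Suc n. tensor_vec (\<sigma> i u) (\<tau> i u)) = T u t'" if u: "u \<in> M \<inter> (A \<inter> B)" for u
  proof -
    have uU: "u \<in> U \<inter> U'"
      using u M(3) by blast
    have "T u t' = T u t + T u (tensor_vec a b)"
      unfolding t'_def using T[OF uU] M(4) ab unfolding linear_on_def by blast
    also have "T u (tensor_vec a b) = tensor_vec (\<phi> u a) (\<psi> u b)"
      using T[OF uU] A(3) B(3) by blast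
    also have "\<phi> u a = \<sigma> n u"
      using u A(4) by simp
    also have "\<psi> u b = \<tau> n u"
      using u B(4) by simp
    also have "T u t = (\<Sum>i<n. tensor_vec (\<sigma> i u) (\<tau> i u))"
      using u M(5) by simp
    finally show ?thesis
      by (simp only: sum.lessThan_Suc)
  qed
  moreover have "t' \<in> tensor_space V V'"
    unfolding t'_def using M(4) ab by (rule coord.subspace_add[OF tensor_space_subspace])
  ultimately show ?case
    using M(1,2,3) AB A(2) B(2) by (intro exI[of _ "M \<inter> (A \<inter> B)"] exI[of _ t']) auto
qed

text \<open>The fibrewise tensor product \<open>T u\<close> of two local trivializations satisfies all conditions of a
  trivialization: its constant sections have open image because they are sums of tensor products
  of sections, and they are continuous because every generating open set has, by the previous
  lemma, constant coefficients with respect to \<open>T\<close>.\<close>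

lemma Loc_tensor_frame:
  assumes E: "E \<in> Loc Z" and E': "E' \<in> Loc Z" and z: "z \<in> topspace Z"
  obtains U V T where "openin Z U" "z \<in> U" "fd_subspace V"
    "\<forall>u\<in>U. linear_on V (T u)"
    "\<forall>u\<in>U. bij_betw (T u) V (stalk (Loc_tensor Z E E') u)"
    "\<forall>t\<in>V. \<forall>N. openin Z N \<longrightarrow> N \<subseteq> U \<longrightarrow>
      openin (etale (Loc_tensor Z E E')) ((\<lambda>u. (u, T u t)) ` N)"
    "\<forall>t\<in>V. lift_to_etale (Loc_tensor Z E E') (subtopology Z U) (\<lambda>u. u) (\<lambda>u. T u t)"
proof -
  obtain U V \<phi> where U: "openin Z U" "z \<in> U" "fd_subspace V" "local_trivialization Z E U V \<phi>"
    using Loc_trivialization[OF E z] .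
  obtain U' V' \<psi> where U': "openin Z U'" "z \<in> U'" "fd_subspace V'" "local_trivialization Z E' U' V' \<psi>"
    using Loc_trivialization[OF E' z] .
  let ?V = "tensor_space V V'" and ?T = "Loc_tensor Z E E'" and ?U = "U \<inter> U'"
  have "\<forall>u\<in>?U. \<exists>T. linear_on ?V T \<and> (\<forall>a\<in>V. \<forall>b\<in>V'. T (tensor_vec a b) = tensor_vec (\<phi> u a) (\<psi> u b))"
    using U(4) U'(4) by (auto intro!: ex_tensor_map U(3) U'(3) local_trivialization_linear)
  then obtain T where T: "linear_on ?V (T u) \<and>
      (\<forall>a\<in>V. \<forall>b\<in>V'. T u (tensor_vec a b) = tensor_vec (\<phi> u a) (\<psi> u b))" if "u \<in> ?U" for u
    by (drule_tac bchoice) blast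
  have UZ: "u \<in> topspace Z" if "u \<in> ?U" for u
    using that openin_subset[OF U(1)] by auto
  have bij: "bij_betw (T u) ?V (stalk ?T u)" if u: "u \<in> ?U" for u
    unfolding stalk_tensor[OF UZ[OF u]]
    using u T[OF u] Loc_fd[OF E UZ[OF u]] Loc_fd[OF E' UZ[OF u]]
    by (intro bij_betw_tensor_map[of _ _ _ _ "\<phi> u" "\<psi> u"] U(3) U'(3)
        local_trivialization_linear[OF U(4)] local_trivialization_linear[OF U'(4)]
        local_trivialization_bij[OF U(4)] local_trivialization_bij[OF U'(4)]) auto
  have opn: "openin (etale ?T) ((\<lambda>u. (u, T u t)) ` N)"
    if t: "t \<in> ?V" and N: "openin Z N" "N \<subseteq> ?U" for t N
  proof -
    obtain n :: nat and a b where ab: "\<forall>i<n. a i \<in> V" "\<forall>i<n. b i \<in> V'"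
      "t = (\<Sum>i<n. tensor_vec (a i) (b i))"
      using tensor_space_sum[OF U(3) t] .
    have Tt: "T u t = (\<Sum>i<n. tensor_vec (\<phi> u (a i)) (\<psi> u (b i)))" if "u \<in> N" for u
    proof -
      have uU: "u \<in> ?U" using that N by blast
      have "T u t = (\<Sum>i<n. T u (tensor_vec (a i) (b i)))"
        unfolding ab(3) using T[OF uU] ab(1,2)
        by (intro linear_on_sum[OF fd_tensor_space[OF U(3) U'(3)]]) (auto intro: tensor_spaceI)
      also have "\<dots> = (\<Sum>i<n. tensor_vec (\<phi> u (a i)) (\<psi> u (b i)))"
        using T[OF uU] ab(1,2) by (intro sum.cong) auto
      finally show ?thesis .
    qed
    have sub: "continuous_map (subtopology Z A) S h \<Longrightarrow> N \<subseteq> A \<Longrightarrow> continuous_map (subtopology Z N) S h"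
      for A h and S :: "('a \<times> (nat \<Rightarrow> 'b)) topology"
      by (rule continuous_map_from_subtopology_mono)
    have "(\<lambda>u. \<phi> u (a i)) \<in> sections_over Z E N" "(\<lambda>u. \<psi> u (b i)) \<in> sections_over Z E' N" if "i < n" for i
      using sub[OF local_trivialization_continuous[OF U(4) ab(1)[rule_format, OF that]]]
        sub[OF local_trivialization_continuous[OF U'(4) ab(2)[rule_format, OF that]]] N(2)
      by (auto simp: sections_over_def)
    then have "openin (etale ?T) ((\<lambda>u. (u, \<Sum>i<n. tensor_vec (\<phi> u (a i)) (\<psi> u (b i)))) ` N)"
      by (intro openin_tensor_sections[OF N(1)]) simp
    then show ?thesis
      using Tt by (simp cong: image_cong)
  qed
  have cont: "lift_to_etale ?T (subtopology Z ?U) (\<lambda>u. u) (\<lambda>u. T u t)" if t: "t \<in> ?V" for t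
  proof (rule continuous_map_into_tensor)
    show "(\<lambda>u. (u, T u t)) ` topspace (subtopology Z ?U) \<subseteq> topspace (etale ?T)"
      using openin_subset[OF opn[OF t, of ?U]] U(1) U'(1) by auto
  next
    fix N and n :: nat and \<sigma> \<tau>
    assume N: "openin Z N" "\<forall>i<n. \<sigma> i \<in> sections_over Z E N \<and> \<tau> i \<in> sections_over Z E' N"
    let ?S = "{y \<in> topspace (subtopology Z ?U). (y, T y t) \<in> (\<lambda>z. (z, \<Sum>i<n. tensor_vec (\<sigma> i z) (\<tau> i z))) ` N}"
    have "openin Z ?S"
    proof (subst openin_subopen, rule ballI)
      fix y assume "y \<in> ?S"
      then have y: "y \<in> N" "y \<in> U" "y \<in> U'" "T y t = (\<Sum>i<n. tensor_vec (\<sigma> i y) (\<tau> i y))"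
        by auto
      obtain M t' where M: "openin Z M" "y \<in> M" "M \<subseteq> N \<inter> ?U" "t' \<in> ?V"
        "\<forall>u\<in>M. (\<Sum>i<n. tensor_vec (\<sigma> i u) (\<tau> i u)) = T u t'"
        using tensor_sections_locally_constant[OF E E' U(1,3,4) U'(1,3,4) T N y(1,2,3)]
        by blast
      \<comment> \<open>Both coefficient vectors are constant near \<open>y\<close>, so equality at \<open>y\<close> spreads.\<close>
      have "T y t = T y t'"
        using y(4) M(2,5) by simp
      then have "t = t'"
        using bij_betw_imp_inj_on[OF bij[of y]] y(2,3) t M(4) by (auto dest: inj_onD)
      have "M \<subseteq> ?S"
      proof
        fix u assume u: "u \<in> M"
        then have "u \<in> N" "u \<in> ?U" "T u t = (\<Sum>i<n. tensor_vec (\<sigma> i u) (\<tau> i u))"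
          using M(3,5) \<open>t = t'\<close> by auto
        then show "u \<in> ?S"
          using UZ by auto
      qed
      with M(1,2) show "\<exists>T. openin Z T \<and> y \<in> T \<and> T \<subseteq> ?S"
        by blast
    qed
    moreover have "?S \<subseteq> ?U"
      by auto
    ultimately show "openin (subtopology Z ?U) ?S"
      by (rule subset_openin_subtopology)
  qed
  show thesis
  proof (rule that)
    show "openin Z ?U" "z \<in> ?U"
      using U U' by auto
    show "fd_subspace ?V"
      by (rule fd_tensor_space[OF U(3) U'(3)])
    show "\<forall>u\<in>?U. linear_on ?V (T u)"
      using T by blast
    show "\<forall>u\<in>?U. bij_betw (T u) ?V (stalk ?T u)"
      using bij by blast
    show "\<forall>t\<in>?V. \<forall>N. openin Z N \<longrightarrow> N \<subseteq> ?U \<longrightarrow> openin (etale ?T) ((\<lambda>u. (u, T u t)) ` N)"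
      using opn by blast
    show "\<forall>t\<in>?V. lift_to_etale ?T (subtopology Z ?U) (\<lambda>u. u) (\<lambda>u. T u t)"
      using cont by blast
  qed
qed

lemma topspace_tensor:
  assumes E: "E \<in> Loc Z" and E': "E' \<in> Loc Z"
  shows "topspace (etale (Loc_tensor Z E E')) = (SIGMA z:topspace Z. stalk (Loc_tensor Z E E') z)"
proof
  show "topspace (etale (Loc_tensor Z E E')) \<subseteq> (SIGMA z:topspace Z. stalk (Loc_tensor Z E E') z)"
  proof
    fix e assume "e \<in> topspace (etale (Loc_tensor Z E E'))"
    then obtain U n \<sigma> \<tau> where G: "e \<in> (\<lambda>z. (z, \<Sum>i<n::nat. tensor_vec (\<sigma> i z) (\<tau> i z))) ` U" "openin Z U"
      "\<forall>i<n. \<sigma> i \<in> sections_over Z E U \<and> \<tau> i \<in> sections_over Z E' U"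
      unfolding Loc_tensor_def local_sys.simps topology_generated_by_topspace
      by (elim UnionE CollectE exE conjE) simp
    then obtain z where z: "z \<in> U" "e = (z, \<Sum>i<n. tensor_vec (\<sigma> i z) (\<tau> i z))"
      by auto
    have zZ: "z \<in> topspace Z"
      using z(1) openin_subset[OF G(2)] by auto
    have "(\<Sum>i<n. tensor_vec (\<sigma> i z) (\<tau> i z)) \<in> tensor_space (stalk E z) (stalk E' z)"
      using G(2,3) z(1) sections_over_stalk[OF E] sections_over_stalk[OF E']
      by (intro coord.subspace_sum[OF tensor_space_subspace] tensor_spaceI) auto
    then show "e \<in> (SIGMA z:topspace Z. stalk (Loc_tensor Z E E') z)"
      using z(2) zZ stalk_tensor[OF zZ] by auto
  qed
  show "(SIGMA z:topspace Z. stalk (Loc_tensor Z E E') z) \<subseteq> topspace (etale (Loc_tensor Z E E'))"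
  proof
    fix e assume "e \<in> (SIGMA z:topspace Z. stalk (Loc_tensor Z E E') z)"
    then obtain z w where e: "e = (z, w)" "z \<in> topspace Z" "w \<in> stalk (Loc_tensor Z E E') z" by auto
    obtain U V T where U: "openin Z U" "z \<in> U" "fd_subspace V"
      "\<forall>u\<in>U. linear_on V (T u)"
      "\<forall>u\<in>U. bij_betw (T u) V (stalk (Loc_tensor Z E E') u)"
      "\<forall>t\<in>V. \<forall>N. openin Z N \<longrightarrow> N \<subseteq> U \<longrightarrow>
        openin (etale (Loc_tensor Z E E')) ((\<lambda>u. (u, T u t)) ` N)"
      "\<forall>t\<in>V. lift_to_etale (Loc_tensor Z E E') (subtopology Z U) (\<lambda>u. u) (\<lambda>u. T u t)"
      using Loc_tensor_frame[OF E E' e(2)] .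
    obtain t where "t \<in> V" "w = T z t"
      using e(3) U(2,5) by (auto simp: bij_betw_def)
    then have "openin (etale (Loc_tensor Z E E')) ((\<lambda>u. (u, T u t)) ` U)" "e \<in> (\<lambda>u. (u, T u t)) ` U"
      using U(1,2,6) e(1) by auto
    then show "e \<in> topspace (etale (Loc_tensor Z E E'))"
      using openin_subset by blast
  qed
qed

lemma continuous_map_tensor_fst:
  assumes E: "E \<in> Loc Z" and E': "E' \<in> Loc Z"
  shows "continuous_map (etale (Loc_tensor Z E E')) Z fst"
  unfolding continuous_map_def
proof (intro conjI allI impI)
  let ?T = "Loc_tensor Z E E'"
  show "fst \<in> topspace (etale ?T) \<rightarrow> topspace Z"
    by (auto simp: topspace_tensor[OF E E'])
  fix G assume G: "openin Z G"
  show "openin (etale ?T) {e \<in> topspace (etale ?T). fst e \<in> G}"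
  proof (subst openin_subopen, rule ballI)
    fix e assume "e \<in> {e \<in> topspace (etale ?T). fst e \<in> G}"
    then obtain z w where e: "e = (z, w)" "z \<in> topspace Z" "w \<in> stalk ?T z" "z \<in> G"
      unfolding topspace_tensor[OF E E'] by auto
    obtain U V T where U: "openin Z U" "z \<in> U" "fd_subspace V"
      "\<forall>u\<in>U. linear_on V (T u)"
      "\<forall>u\<in>U. bij_betw (T u) V (stalk (Loc_tensor Z E E') u)"
      "\<forall>t\<in>V. \<forall>N. openin Z N \<longrightarrow> N \<subseteq> U \<longrightarrow>
        openin (etale (Loc_tensor Z E E')) ((\<lambda>u. (u, T u t)) ` N)"
      "\<forall>t\<in>V. lift_to_etale (Loc_tensor Z E E') (subtopology Z U) (\<lambda>u. u) (\<lambda>u. T u t)"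
      using Loc_tensor_frame[OF E E' e(2)] .
    obtain t where t: "t \<in> V" "w = T z t"
      using e(3) U(2,5) by (auto simp: bij_betw_def)
    let ?N = "(\<lambda>u. (u, T u t)) ` (U \<inter> G)"
    have "openin (etale ?T) ?N"
      using U(1,6) t(1) G by auto
    moreover have "e \<in> ?N"
      using U(2) e t(2) by auto
    moreover have "?N \<subseteq> {e \<in> topspace (etale ?T). fst e \<in> G}"
      using openin_subset[OF \<open>openin (etale ?T) ?N\<close>] by auto
    ultimately show "\<exists>S. openin (etale ?T) S \<and> e \<in> S \<and> S \<subseteq> {e \<in> topspace (etale ?T). fst e \<in> G}"
      by blast
  qed
qed

lemma Loc_tensor_in_Loc:
  assumes E: "E \<in> Loc Z" and E': "E' \<in> Loc Z"
  shows "Loc_tensor Z E E' \<in> Loc Z"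
proof -
  let ?T = "Loc_tensor Z E E'"
  have "\<forall>z\<in>topspace Z. \<exists>U V \<phi>. openin Z U \<and> z \<in> U \<and> fd_subspace V \<and>
      local_trivialization Z ?T U V \<phi>"
  proof
    fix z assume z: "z \<in> topspace Z"
    obtain U V T where U: "openin Z U" "z \<in> U" "fd_subspace V"
      "\<forall>u\<in>U. linear_on V (T u)"
      "\<forall>u\<in>U. bij_betw (T u) V (stalk (Loc_tensor Z E E') u)"
      "\<forall>t\<in>V. \<forall>N. openin Z N \<longrightarrow> N \<subseteq> U \<longrightarrow>
        openin (etale (Loc_tensor Z E E')) ((\<lambda>u. (u, T u t)) ` N)"
      "\<forall>t\<in>V. lift_to_etale (Loc_tensor Z E E') (subtopology Z U) (\<lambda>u. u) (\<lambda>u. T u t)"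
      using Loc_tensor_frame[OF E E' z] .
    have "local_trivialization Z ?T U V T"
      using U(4-7) by (intro local_trivializationI[OF U(1) topspace_tensor[OF E E']]) auto
    with U(1-3) show "\<exists>U V \<phi>. openin Z U \<and> z \<in> U \<and> fd_subspace V \<and>
        local_trivialization Z ?T U V \<phi>"
      by (intro exI conjI)
  qed
  moreover have "\<forall>z. z \<notin> topspace Z \<longrightarrow> stalk ?T z = {}"
    by (simp add: Loc_tensor_def)
  moreover have "\<forall>z\<in>topspace Z. fd_subspace (stalk ?T z)"
    by (simp add: stalk_tensor fd_tensor_space Loc_fd[OF E] Loc_fd[OF E'])
  ultimately show ?thesis
    using topspace_tensor[OF E E'] continuous_map_tensor_fst[OF E E'] unfolding Loc_def
    by (intro CollectI conjI)
qed

section \<open>Parallel transport along a homotopy\<close>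

abbreviation cylinder :: "real \<Rightarrow> real \<Rightarrow> 'z topology \<Rightarrow> 'z set \<Rightarrow> (real \<times> 'z) topology"
  where "cylinder a b Z U \<equiv> prod_topology (top_of_set {a..b}) (subtopology Z U)"

lemma lift_to_etale_reparam:
  assumes "lift_to_etale E Y p a" "continuous_map Y' Y q"
  shows "lift_to_etale E Y' (\<lambda>y. p (q y)) (\<lambda>y. a (q y))"
  using continuous_map_compose[OF assms(2,1)] by (simp add: o_def)

lemma continuous_map_cylinder_slice:
  assumes "t \<in> {a..b}"
  shows "continuous_map (subtopology Z U) (cylinder a b Z U) (\<lambda>u. (t, u))"
  using assms by (simp add: continuous_map_pairwise o_def)

lemma continuous_map_cylinder_path:
  assumes "u \<in> U" "u \<in> topspace Z"
  shows "continuous_map (top_of_set {a..b}) (cylinder a b Z U) (\<lambda>t. (t, u))"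
  using assms by (simp add: continuous_map_pairwise o_def)

lemma continuous_map_cylinder_mono:
  assumes "{a..b} \<subseteq> {c..d}" "U \<subseteq> U'"
  shows "continuous_map (cylinder a b Z U) (cylinder c d Z U') (\<lambda>y. y)"
proof -
  have "continuous_map (cylinder a b Z U) (top_of_set {c..d}) fst"
    using continuous_map_fst[of "top_of_set {a..b}" "subtopology Z U"] assms(1)
    by (auto simp: continuous_map_in_subtopology)
  moreover have "continuous_map (cylinder a b Z U) (subtopology Z U') snd"
    using continuous_map_snd[of "top_of_set {a..b}" "subtopology Z U"] assms(2)
    by (auto simp: continuous_map_in_subtopology)
  ultimately show ?thesis
    by (simp add: continuous_map_pairwise o_def)
qed

locale homotopy_local_system =
  fixes Z :: "'z topology" and K :: "real \<times> 'z \<Rightarrow> 'z" and E :: "('z, 'k::field) local_sys"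
  assumes K: "continuous_map (cylinder 0 1 Z UNIV) Z K" and E: "E \<in> Loc Z"
begin

lemma K_cylinder:
  assumes "{a..b} \<subseteq> {0..1}"
  shows "continuous_map (cylinder a b Z U) Z K"
  using continuous_map_compose[OF continuous_map_cylinder_mono[OF assms subset_UNIV] K, of U] by (simp add: o_def)

lemma K_topspace: "t \<in> {0..1} \<Longrightarrow> z \<in> topspace Z \<Longrightarrow> K (t, z) \<in> topspace Z"
  using continuous_map_image_subset_topspace[OF K] by (simp add: image_subset_iff)

definition transports :: "'z \<Rightarrow> (nat \<Rightarrow> 'k) \<Rightarrow> (nat \<Rightarrow> 'k) \<Rightarrow> bool"
  where "transports z v w \<longleftrightarrow>
    (\<exists>\<sigma>. lift_to_etale E (top_of_set {0..1}) (\<lambda>t. K (t, z)) \<sigma> \<and> \<sigma> 0 = v \<and> \<sigma> 1 = w)"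

text \<open>The unit interval is connected, so a flat section is determined by its initial value.\<close>

lemma transports_unique:
  assumes "transports z v w" "transports z v w'"
  shows "w = w'"
proof -
  obtain \<sigma> where \<sigma>: "lift_to_etale E (top_of_set {0..1}) (\<lambda>t. K (t, z)) \<sigma>" "\<sigma> 0 = v" "\<sigma> 1 = w"
    using assms(1) unfolding transports_def by (elim exE conjE)
  obtain \<tau> where \<tau>: "lift_to_etale E (top_of_set {0..1}) (\<lambda>t. K (t, z)) \<tau>" "\<tau> 0 = v" "\<tau> 1 = w'"
    using assms(2) unfolding transports_def by (elim exE conjE)
  let ?I = "top_of_set {0..1::real}"
  let ?S = "{t \<in> topspace ?I. \<sigma> t = \<tau> t}"
  have "connected_space ?I"
    by (intro connected_space_subtopology) (simp add: is_interval_connected)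
  moreover have "openin ?I ?S"
    by (rule lift_to_etale_equalizer(1)[OF E \<sigma>(1) \<tau>(1)])
  moreover have "closedin ?I ?S"
  proof -
    have "topspace ?I - ?S = {t \<in> topspace ?I. \<sigma> t \<noteq> \<tau> t}"
      by blast
    then have "openin ?I (topspace ?I - ?S)"
      by (simp only: lift_to_etale_equalizer(2)[OF E \<sigma>(1) \<tau>(1)])
    moreover have "?S \<subseteq> topspace ?I"
      by blast
    ultimately show ?thesis
      by (simp only: closedin_def simp_thms)
  qed
  ultimately have "?S = {} \<or> ?S = topspace ?I"
    unfolding connected_space_clopen_in by blast
  moreover have "0 \<in> ?S"
    using \<sigma>(2) \<tau>(2) by simp
  moreover have "1 \<in> topspace ?I"
    by simp
  ultimately have "1 \<in> ?S"
    by (elim disjE) (blast, simp only:)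
  then show ?thesis
    using \<sigma>(3) \<tau>(3) by simp
qed

lemma transports_linear:
  assumes "transports z v w" "transports z v' w'"
  shows "transports z (v + v') (w + w')" "transports z (cscale c v) (cscale c w)"
proof -
  obtain \<sigma> where \<sigma>: "lift_to_etale E (top_of_set {0..1}) (\<lambda>t. K (t, z)) \<sigma>" "\<sigma> 0 = v" "\<sigma> 1 = w"
    using assms(1) unfolding transports_def by (elim exE conjE)
  obtain \<tau> where \<tau>: "lift_to_etale E (top_of_set {0..1}) (\<lambda>t. K (t, z)) \<tau>" "\<tau> 0 = v'" "\<tau> 1 = w'"
    using assms(2) unfolding transports_def by (elim exE conjE)
  show "transports z (v + v') (w + w')"
    unfolding transports_def using lift_to_etale_add[OF E \<sigma>(1) \<tau>(1)] \<sigma>(2,3) \<tau>(2,3)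
    by (intro exI[of _ "\<lambda>t. \<sigma> t + \<tau> t"] conjI) (simp_all only:)
  show "transports z (cscale c v) (cscale c w)"
    unfolding transports_def using lift_to_etale_scale[OF E \<sigma>(1), of c] \<sigma>(2,3)
    by (intro exI[of _ "\<lambda>t. cscale c (\<sigma> t)"] conjI) (simp_all only:)
qed

text \<open>Along a constant path the constant section is flat.  At the base point this makes transport the
  identity on the stalk.\<close>

lemma transports_stationary:
  assumes z: "z \<in> topspace Z" and v: "v \<in> stalk E z" and stat: "\<forall>t\<in>{0..1}. K (t, z) = z"
  shows "transports z v v"
proof -
  have "continuous_map (top_of_set {0..1}) (etale E) (\<lambda>t. (z, v))"
    using Loc_topspace[OF E] z v by simp
  then have "lift_to_etale E (top_of_set {0..1}) (\<lambda>t. K (t, z)) (\<lambda>t. v)"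
    by (rule continuous_map_eq) (use stat in simp)
  then show ?thesis
    unfolding transports_def by (intro exI[of _ "\<lambda>t. v"]) simp
qed

text \<open>Flat sections extend over short time intervals because of local triviality and can be
  concatenated because two of them agree on an open set; Bolzano's bisection does the rest.\<close>

definition extends_flat :: "'z \<Rightarrow> real \<Rightarrow> real \<Rightarrow> bool"
  where "extends_flat z a b \<longleftrightarrow> (\<forall>v\<in>stalk E (K (a, z)). \<exists>U \<sigma>. openin Z U \<and> z \<in> U \<and> \<sigma> (a, z) = v \<and>
    lift_to_etale E (cylinder a b Z U) K \<sigma>)"

text \<open>Choosing the second family to match the first at \<open>(b, z)\<close> makes them match at time \<open>b\<close> on a whole
  neighbourhood of \<open>z\<close>, over which they are glued along the closed sets before and after \<open>b\<close>.\<close>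

lemma extends_flat_trans:
  assumes ab: "extends_flat z a b" and bc: "extends_flat z b c"
    and le: "0 \<le> a" "a \<le> b" "b \<le> c" "c \<le> 1" and z: "z \<in> topspace Z"
  shows "extends_flat z a c"
  unfolding extends_flat_def
proof
  fix v assume "v \<in> stalk E (K (a, z))"
  with ab obtain U \<sigma> where U: "openin Z U" "z \<in> U" "\<sigma> (a, z) = v"
    "lift_to_etale E (cylinder a b Z U) K \<sigma>"
    unfolding extends_flat_def by meson
  have "(b, z) \<in> topspace (cylinder a b Z U)"
    using le z U(2) by simp
  from lift_to_etale_stalk(2)[OF E U(4) this] bc
  obtain U' \<tau> where U': "openin Z U'" "z \<in> U'" "\<tau> (b, z) = \<sigma> (b, z)"
    "lift_to_etale E (cylinder b c Z U') K \<tau>"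
    unfolding extends_flat_def by meson
  let ?W = "U \<inter> U'"
  \<comment> \<open>The base of the glued family: the two families agree there at the junction.\<close>
  let ?M = "{u \<in> topspace (subtopology Z ?W). \<sigma> (b, u) = \<tau> (b, u)}"
  have slice: "continuous_map (subtopology Z ?W) (cylinder a b Z U) (\<lambda>u. (b, u))"
    "continuous_map (subtopology Z ?W) (cylinder b c Z U') (\<lambda>u. (b, u))"
    using le by (simp_all add: continuous_map_pairwise o_def continuous_map_in_subtopology image_subset_iff
        continuous_map_from_subtopology)
  have "openin (subtopology Z ?W) ?M"
    by (rule lift_to_etale_equalizer(1)[OF E lift_to_etale_reparam[OF U(4) slice(1)]
          lift_to_etale_reparam[OF U'(4) slice(2)]])
  then have M: "openin Z ?M"
    using U(1) U'(1) by (meson openin_Int openin_trans_full)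
  let ?C = "cylinder a c Z ?M"
  have "continuous_map ?C (etale E)
      (\<lambda>y. if fst y \<le> b then (K y, \<sigma> y) else (K y, \<tau> y))"
  proof (rule continuous_map_cases_le)
    show "continuous_map ?C euclideanreal fst"
      using continuous_map_fst[of "top_of_set {a..c}" "subtopology Z ?M"]
      by (simp add: continuous_map_in_subtopology)
    show "continuous_map ?C euclideanreal (\<lambda>y. b)"
      by simp
    have "continuous_map (subtopology ?C {y \<in> topspace ?C. fst y \<le> b}) (cylinder a b Z U) (\<lambda>y. y)"
      using continuous_map_fst[of "top_of_set {a..c}" "subtopology Z ?M"]
        continuous_map_snd[of "top_of_set {a..c}" "subtopology Z ?M"]
      by (auto simp: continuous_map_pairwise o_def continuous_map_in_subtopology
          continuous_map_from_subtopology)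
    from lift_to_etale_reparam[OF U(4) this]
    show "lift_to_etale E (subtopology ?C {y \<in> topspace ?C. fst y \<le> b}) K \<sigma>" .
    have "continuous_map (subtopology ?C {y \<in> topspace ?C. b \<le> fst y}) (cylinder b c Z U') (\<lambda>y. y)"
      using continuous_map_fst[of "top_of_set {a..c}" "subtopology Z ?M"]
        continuous_map_snd[of "top_of_set {a..c}" "subtopology Z ?M"]
      by (auto simp: continuous_map_pairwise o_def continuous_map_in_subtopology
          continuous_map_from_subtopology)
    from lift_to_etale_reparam[OF U'(4) this]
    show "lift_to_etale E (subtopology ?C {y \<in> topspace ?C. b \<le> fst y}) K \<tau>" .
    fix y assume "y \<in> topspace ?C" "fst y = b"
    then show "(K y, \<sigma> y) = (K y, \<tau> y)"
      by (cases y) simp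
  qed
  then have "lift_to_etale E ?C K (\<lambda>y. if fst y \<le> b then \<sigma> y else \<tau> y)"
    by (rule continuous_map_eq) simp
  moreover have "z \<in> ?M"
    using U(2) U'(2,3) z by simp
  ultimately show "\<exists>U \<sigma>. openin Z U \<and> z \<in> U \<and> \<sigma> (a, z) = v \<and> lift_to_etale E (cylinder a c Z U) K \<sigma>"
    using M U(3) le(2) by (intro exI[of _ ?M] exI[of _ "\<lambda>y. if fst y \<le> b then \<sigma> y else \<tau> y"]) simp
qed

lemma extends_flat_local:
  assumes t: "t \<in> {0..1}" and z: "z \<in> topspace Z"
  obtains d where "d > 0"
    "\<And>a b. a \<le> t \<Longrightarrow> t \<le> b \<Longrightarrow> b - a < d \<Longrightarrow> 0 \<le> a \<Longrightarrow> b \<le> 1 \<Longrightarrow> extends_flat z a b"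
proof -
  obtain U V \<phi> where U: "openin Z U" "K (t, z) \<in> U" "fd_subspace V" "local_trivialization Z E U V \<phi>"
    using Loc_trivialization[OF E K_topspace[OF t z]] .
  have "openin (cylinder 0 1 Z UNIV) {y \<in> topspace (cylinder 0 1 Z UNIV). K y \<in> U}"
    by (rule openin_continuous_map_preimage[OF K U(1)])
  moreover have "(t, z) \<in> {y \<in> topspace (cylinder 0 1 Z UNIV). K y \<in> U}"
    using t z U(2) by simp
  ultimately obtain A B where AB: "openin (top_of_set {0..1}) A" "openin Z B" "t \<in> A" "z \<in> B"
    "A \<times> B \<subseteq> {y \<in> topspace (cylinder 0 1 Z UNIV). K y \<in> U}"
    unfolding openin_prod_topology_alt subtopology_UNIV by meson
  obtain d where d: "d > 0" "\<forall>t'\<in>{0..1}. dist t' t < d \<longrightarrow> t' \<in> A"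
    using AB(1,3) unfolding openin_euclidean_subtopology_iff by blast
  have "extends_flat z a b" if ab: "a \<le> t" "t \<le> b" "b - a < d" "0 \<le> a" "b \<le> 1" for a b
    unfolding extends_flat_def
  proof
    fix v assume v: "v \<in> stalk E (K (a, z))"
    have sub: "{a..b} \<subseteq> {0..1}"
      using ab by auto
    have "{a..b} \<subseteq> A"
      using d(2) ab by (auto simp: dist_real_def)
    then have KU: "K (t', u) \<in> U" if "t' \<in> {a..b}" "u \<in> B" for t' u
      using AB(5) that by blast
    have "a \<in> {a..b}"
      using ab by simp
    then have "v \<in> \<phi> (K (a, z)) ` V"
      using v local_trivialization_bij[OF U(4) KU[OF _ AB(4)]] by (simp add: bij_betw_def)
    then obtain w where w: "w \<in> V" "v = \<phi> (K (a, z)) w"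
      by blast
    have "continuous_map (cylinder a b Z B) (subtopology Z U) K"
      using K_cylinder[OF sub] KU by (auto simp: continuous_map_in_subtopology)
    from continuous_map_compose[OF this local_trivialization_continuous[OF U(4) w(1)]]
    have "lift_to_etale E (cylinder a b Z B) K (\<lambda>y. \<phi> (K y) w)"
      by (simp add: o_def)
    then show "\<exists>U \<sigma>. openin Z U \<and> z \<in> U \<and> \<sigma> (a, z) = v \<and> lift_to_etale E (cylinder a b Z U) K \<sigma>"
      using AB(2,4) w(2) by (intro exI[of _ B] exI[of _ "\<lambda>y. \<phi> (K y) w"]) simp
  qed
  with d(1) show thesis
    using that by blast
qed

lemma extends_flat_unit_interval:
  assumes z: "z \<in> topspace Z"
  shows "extends_flat z 0 1"
proof -
  \<comment> \<open>The local hypothesis of Bolzano's lemma ranges over all short intervals around a time; the guards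
    restrict it to the domain of \<open>K\<close>.\<close>
  have "0 \<le> a \<longrightarrow> b \<le> 1 \<longrightarrow> extends_flat z a b" if "a = 0" "b = 1" for a b :: real
  proof -
    have "a \<le> b" using that by simp
    then show ?thesis
    proof (induction rule: Bolzano)
      case (trans a b c)
      then show ?case
        using extends_flat_trans[OF _ _ _ _ _ _ z, of a b c] by linarith
    next
      case (local t)
      then have "t \<in> {0..1}" using that by simp
      then obtain d where "d > 0"
        "\<And>a b. a \<le> t \<Longrightarrow> t \<le> b \<Longrightarrow> b - a < d \<Longrightarrow> 0 \<le> a \<Longrightarrow> b \<le> 1 \<Longrightarrow> extends_flat z a b"
        using extends_flat_local[OF _ z] by blast
      then show ?case
        by (intro exI[of _ d]) blast
    qed
  qed
  then show ?thesis by simp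
qed

definition transport :: "'z \<Rightarrow> (nat \<Rightarrow> 'k) \<Rightarrow> nat \<Rightarrow> 'k"
  where "transport z v = (THE w. transports z v w)"

lemma transport_eq: "transports z v w \<Longrightarrow> transport z v = w"
  unfolding transport_def using transports_unique by blast

end

locale homotopy_from_id = homotopy_local_system +
  assumes K0: "\<And>z. z \<in> topspace Z \<Longrightarrow> K (0, z) = z"
begin

lemma transport_family:
  assumes z: "z \<in> topspace Z" and v: "v \<in> stalk E z"
  obtains U \<sigma> where "openin Z U" "z \<in> U" "\<sigma> (0, z) = v" "lift_to_etale E (cylinder 0 1 Z U) K \<sigma>"
    "\<forall>u\<in>U. transports u (\<sigma> (0, u)) (\<sigma> (1, u))"
proof -
  have "v \<in> stalk E (K (0, z))"
    using v K0[OF z] by simp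
  then obtain U \<sigma> where U: "openin Z U" "z \<in> U" "\<sigma> (0, z) = v" "lift_to_etale E (cylinder 0 1 Z U) K \<sigma>"
    using extends_flat_unit_interval[OF z] unfolding extends_flat_def by meson
  have "transports u (\<sigma> (0, u)) (\<sigma> (1, u))" if "u \<in> U" for u
  proof -
    have "u \<in> topspace Z"
      using that openin_subset[OF U(1)] by blast
    from lift_to_etale_reparam[OF U(4) continuous_map_cylinder_path[OF that this]]
    show ?thesis
      unfolding transports_def by (intro exI[of _ "\<lambda>t. \<sigma> (t, u)"]) simp
  qed
  then have "\<forall>u\<in>U. transports u (\<sigma> (0, u)) (\<sigma> (1, u))"
    by blast
  with U show thesis
    by (rule that)
qed

lemma transports_transport:
  assumes "z \<in> topspace Z" "v \<in> stalk E z"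
  shows "transports z v (transport z v)"
proof -
  obtain U \<sigma> where "openin Z U" "z \<in> U" "\<sigma> (0, z) = v" "lift_to_etale E (cylinder 0 1 Z U) K \<sigma>"
    "\<forall>u\<in>U. transports u (\<sigma> (0, u)) (\<sigma> (1, u))"
    using transport_family[OF assms] .
  then show ?thesis
    using transport_eq by metis
qed

lemma transport_linear:
  assumes z: "z \<in> topspace Z"
  shows "linear_on (stalk E z) (transport z)"
  unfolding linear_on_def
  using transport_eq[OF transports_linear(1)[OF transports_transport[OF z] transports_transport[OF z]]]
    transport_eq[OF transports_linear(2)[OF transports_transport[OF z] transports_transport[OF z]]]
  by blast

lemma transport_stationary:
  assumes "z \<in> topspace Z" "v \<in> stalk E z" "\<forall>t\<in>{0..1}. K (t, z) = z"
  shows "transport z v = v"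
  by (rule transport_eq[OF transports_stationary[OF assms]])

text \<open>Near a point the section through it extends to a flat family over a cylinder, and along this
  section transport is the end of that family.\<close>

lemma lift_to_etale_transport:
  "lift_to_etale E (etale E) (\<lambda>e. K (1, fst e)) (\<lambda>e. transport (fst e) (snd e))"
proof (rule continuous_map_from_etale[OF E])
  fix z v assume zv: "z \<in> topspace Z" "v \<in> stalk E z"
  obtain U \<sigma> where U: "openin Z U" "z \<in> U" "\<sigma> (0, z) = v" "lift_to_etale E (cylinder 0 1 Z U) K \<sigma>"
    "\<forall>u\<in>U. transports u (\<sigma> (0, u)) (\<sigma> (1, u))"
    using transport_family[OF zv] .
  have slice: "lift_to_etale E (subtopology Z U) (\<lambda>u. K (t, u)) (\<lambda>u. \<sigma> (t, u))" if "t \<in> {0..1}" for t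
    using lift_to_etale_reparam[OF U(4) continuous_map_cylinder_slice[OF that]] .
  have eq: "transport u (\<sigma> (0, u)) = \<sigma> (1, u)" if "u \<in> U" for u
    using transport_eq U(5) that by blast
  have "lift_to_etale E (subtopology Z U) (\<lambda>u. u) (\<lambda>u. \<sigma> (0, u))"
    by (rule continuous_map_eq[OF slice[of 0]]) (simp_all add: K0)
  moreover have "lift_to_etale E (subtopology Z U) (\<lambda>u. K (1, u)) (\<lambda>u. transport u (\<sigma> (0, u)))"
    by (rule continuous_map_eq[OF slice[of 1]]) (simp_all add: eq)
  ultimately show "\<exists>N \<sigma>. openin Z N \<and> z \<in> N \<and> \<sigma> z = v \<and>
      lift_to_etale E (subtopology Z N) (\<lambda>u. u) \<sigma> \<and>
      continuous_map (subtopology Z N) (etale E)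
        (\<lambda>u. (K (1, fst (u, \<sigma> u)), transport (fst (u, \<sigma> u)) (snd (u, \<sigma> u))))"
    using U(1-3) by (intro exI[of _ U] exI[of _ "\<lambda>u. \<sigma> (0, u)"]) simp
qed

end

section \<open>Functoriality of the Tannakian dual\<close>

text \<open>In this direction continuity is immediate, because sections pull back to sections and so the
  preimage of a generating open set is again one.\<close>

lemma pullback_tensor_hom:
  assumes f: "continuous_map Z W f" and E: "E \<in> Loc W" and E': "E' \<in> Loc W"
  shows "(\<lambda>z v. v) \<in> Loc_hom Z (Loc_tensor Z (Loc_pullback Z f E) (Loc_pullback Z f E'))
    (Loc_pullback Z f (Loc_tensor W E E'))"
proof -
  let ?P = "Loc_pullback Z f E" and ?P' = "Loc_pullback Z f E'"
  let ?T = "Loc_tensor Z ?P ?P'"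
  note P = Loc_pullback_in_Loc[OF f E] and P' = Loc_pullback_in_Loc[OF f E']
  have fW: "f z \<in> topspace W" if "z \<in> topspace Z" for z
    using f that by (auto simp: continuous_map_def)
  have stalk: "stalk ?T z = stalk (Loc_tensor W E E') (f z)" if "z \<in> topspace Z" for z
    using that fW[OF that] by (simp add: stalk_tensor stalk_pullback)
  have "lift_to_etale (Loc_tensor W E E') (etale ?T) (\<lambda>e. f (fst e)) snd"
  proof (rule continuous_map_into_tensor)
    show "(\<lambda>e. (f (fst e), snd e)) ` topspace (etale ?T) \<subseteq> topspace (etale (Loc_tensor W E E'))"
      unfolding topspace_tensor[OF P P'] topspace_tensor[OF E E'] using fW stalk by auto
  next
    fix U and n :: nat and \<sigma> \<tau>
    assume U: "openin W U" and sec: "\<forall>i<n. \<sigma> i \<in> sections_over W E U \<and> \<tau> i \<in> sections_over W E' U"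
    let ?U = "{z \<in> topspace Z. f z \<in> U}"
    let ?G = "(\<lambda>z. (z, \<Sum>i<n. tensor_vec (\<sigma> i (f z)) (\<tau> i (f z)))) ` ?U"
    have oU: "openin Z ?U"
      using f U by (rule openin_continuous_map_preimage)
    have fU: "continuous_map (subtopology Z ?U) (subtopology W U) f"
      using f by (auto simp: continuous_map_in_subtopology continuous_map_from_subtopology)
    have pull: "(\<lambda>z. \<rho> (f z)) \<in> sections_over Z (Loc_pullback Z f D) ?U"
      if "D \<in> Loc W" "\<rho> \<in> sections_over W D U" for D \<rho>
    proof -
      have "lift_to_etale D (subtopology Z ?U) f (\<lambda>z. \<rho> (f z))"
        using lift_to_etale_reparam[OF _ fU, of D "\<lambda>u. u" \<rho>] that(2) by (simp add: sections_over_def)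
      then have "lift_to_etale (Loc_pullback Z f D) (subtopology Z ?U) (\<lambda>z. z) (\<lambda>z. \<rho> (f z))"
        by (intro lift_to_etale_pullbackI[OF that(1)]) (simp_all add: continuous_map_from_subtopology)
      then show ?thesis
        by (simp add: sections_over_def)
    qed
    have opn: "openin (etale ?T) ?G"
      using sec pull[OF E] pull[OF E'] by (intro openin_tensor_sections[OF oU]) blast
    have "{e \<in> topspace (etale ?T). (f (fst e), snd e) \<in> (\<lambda>w. (w, \<Sum>i<n. tensor_vec (\<sigma> i w) (\<tau> i w))) ` U} = ?G"
      (is "?A = _")
    proof
      show "?A \<subseteq> ?G"
      proof
        fix e assume "e \<in> ?A"
        then have "fst e \<in> topspace Z" "f (fst e) \<in> U"
          "snd e = (\<Sum>i<n. tensor_vec (\<sigma> i (f (fst e))) (\<tau> i (f (fst e))))"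
          unfolding topspace_tensor[OF P P'] by auto
        then show "e \<in> ?G"
          by (intro image_eqI[of _ _ "fst e"]) (simp_all add: prod_eq_iff)
      qed
      show "?G \<subseteq> ?A"
        using openin_subset[OF opn] by auto
    qed
    with opn show "openin (etale ?T) ?A"
      by (simp only:)
  qed
  then have "lift_to_etale (Loc_pullback Z f (Loc_tensor W E E')) (etale ?T) fst snd"
    by (intro lift_to_etale_pullbackI[OF Loc_tensor_in_Loc[OF E E']] Loc_proj[OF Loc_tensor_in_Loc[OF P P']])
  then show ?thesis
    by (intro Loc_homI) (auto simp: linear_on_def stalk stalk_pullback)
qed

lemma pullback_unit_hom:
  assumes f: "continuous_map Z W f"
  shows "(\<lambda>z v. v) \<in> Loc_hom Z (Loc_unit Z) (Loc_pullback Z f (Loc_unit W))"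
proof (rule Loc_homI)
  have fW: "f z \<in> topspace W" if "z \<in> topspace Z" for z
    using f that by (auto simp: continuous_map_def)
  show "linear_on (stalk (Loc_unit Z) z) (\<lambda>v. v)" for z
    by (simp add: linear_on_def)
  show "(\<lambda>v. v) ` stalk (Loc_unit Z) z \<subseteq> stalk (Loc_pullback Z f (Loc_unit W)) z"
    if "z \<in> topspace Z" for z
    using fW[OF that] that by (simp add: stalk_pullback Loc_unit_def)
  have "continuous_map (etale (Loc_unit Z)) W (f \<circ> fst)"
    by (rule continuous_map_compose[OF Loc_proj[OF Loc_unit_in_Loc] f])
  then have "lift_to_etale (Loc_unit W) (etale (Loc_unit Z)) (\<lambda>e. f (fst e)) snd"
    by (simp add: Loc_unit_def continuous_map_pairwise o_def continuous_map_snd)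
  then show "lift_to_etale (Loc_pullback Z f (Loc_unit W)) (etale (Loc_unit Z)) fst (\<lambda>e. snd e)"
    by (intro lift_to_etale_pullbackI[OF Loc_unit_in_Loc Loc_proj[OF Loc_unit_in_Loc]])
qed

text \<open>The pullback of a tensor product and the tensor product of the pullbacks have the same stalks but
  need not be the same set, so compatibility with tensor products rests on
  \<open>tensor_automorphism_eq\<close>; likewise for the unit.\<close>

lemma tannaka_map_in_tensor_automorphisms:
  assumes s: "is_ring_hom s" and f: "continuous_map Z W f" and z: "z \<in> topspace Z"
    and \<alpha>: "\<alpha> \<in> tensor_automorphisms Z z s"
  shows "tannaka_map Z W f \<alpha> \<in> tensor_automorphisms W (f z) s"
proof -
  let ?\<beta> = "tannaka_map Z W f \<alpha>"
  have \<beta>: "?\<beta> E = \<alpha> (Loc_pullback Z f E)" if "E \<in> Loc W" for E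
    using that by (simp add: tannaka_map_def)
  note P = Loc_pullback_in_Loc[OF f]
  note stalk = stalk_pullback[OF z, of f]
  have 1: "?\<beta> \<in> extensional (Loc W)"
    by (simp add: tannaka_map_def)
  have 2: "?\<beta> E \<in> extensional (base_change s (stalk E (f z))) \<and>
      linear_on (base_change s (stalk E (f z))) (?\<beta> E) \<and>
      bij_betw (?\<beta> E) (base_change s (stalk E (f z))) (base_change s (stalk E (f z)))"
    if E: "E \<in> Loc W" for E
  proof -
    have "\<forall>E\<in>Loc Z. \<alpha> E \<in> extensional (base_change s (stalk E z)) \<and>
        linear_on (base_change s (stalk E z)) (\<alpha> E) \<and>
        bij_betw (\<alpha> E) (base_change s (stalk E z)) (base_change s (stalk E z))"
      using \<alpha> unfolding tensor_automorphisms_def by blast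
    from bspec[OF this P[OF E]] show ?thesis
      unfolding \<beta>[OF E] stalk .
  qed
  have 3: "?\<beta> E' (extend_scalars s (stalk E (f z)) (\<lambda>v. s \<circ> \<phi> (f z) v) x)
      = extend_scalars s (stalk E (f z)) (\<lambda>v. s \<circ> \<phi> (f z) v) (?\<beta> E x)"
    if E: "E \<in> Loc W" and E': "E' \<in> Loc W" and \<phi>: "\<phi> \<in> Loc_hom W E E'"
      and x: "x \<in> base_change s (stalk E (f z))" for E E' \<phi> x
  proof -
    have "\<forall>E\<in>Loc Z. \<forall>E'\<in>Loc Z. \<forall>\<phi>\<in>Loc_hom Z E E'. \<forall>x\<in>base_change s (stalk E z).
        \<alpha> E' (extend_scalars s (stalk E z) (\<lambda>v. s \<circ> \<phi> z v) x)
          = extend_scalars s (stalk E z) (\<lambda>v. s \<circ> \<phi> z v) (\<alpha> E x)"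
      using \<alpha> unfolding tensor_automorphisms_def by blast
    from bspec[OF bspec[OF bspec[OF bspec[OF this P[OF E]] P[OF E']] Loc_hom_pullback[OF f E E' \<phi>]],
      unfolded stalk, OF x]
    show ?thesis
      unfolding \<beta>[OF E] \<beta>[OF E'] .
  qed
  have 4: "?\<beta> (Loc_tensor W E E') (tensor_vec x y) = tensor_vec (?\<beta> E x) (?\<beta> E' y)"
    if E: "E \<in> Loc W" and E': "E' \<in> Loc W" and x: "x \<in> base_change s (stalk E (f z))"
      and y: "y \<in> base_change s (stalk E' (f z))" for E E' x y
  proof -
    let ?D = "Loc_tensor Z (Loc_pullback Z f E) (Loc_pullback Z f E')"
    have fz: "f z \<in> topspace W"
      using f z by (auto simp: continuous_map_def)
    have "\<alpha> ?D = \<alpha> (Loc_pullback Z f (Loc_tensor W E E'))"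
      by (rule tensor_automorphism_eq[OF s \<alpha> Loc_tensor_in_Loc[OF P[OF E] P[OF E']]
            P[OF Loc_tensor_in_Loc[OF E E']] z pullback_tensor_hom[OF f E E']])
        (simp_all add: stalk_tensor stalk stalk_tensor[OF fz] z)
    moreover have "\<forall>E\<in>Loc Z. \<forall>E'\<in>Loc Z.
        \<forall>x\<in>base_change s (stalk E z). \<forall>y\<in>base_change s (stalk E' z).
        \<alpha> (Loc_tensor Z E E') (tensor_vec x y) = tensor_vec (\<alpha> E x) (\<alpha> E' y)"
      using \<alpha> unfolding tensor_automorphisms_def by blast
    from bspec[OF bspec[OF bspec[OF bspec[OF this P[OF E]] P[OF E']], unfolded stalk, OF x] y]
    have "\<alpha> ?D (tensor_vec x y) = tensor_vec (\<alpha> (Loc_pullback Z f E) x) (\<alpha> (Loc_pullback Z f E') y)" .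
    ultimately show ?thesis
      unfolding \<beta>[OF E] \<beta>[OF E'] \<beta>[OF Loc_tensor_in_Loc[OF E E']] by simp
  qed
  have 5: "?\<beta> (Loc_unit W) x = x" if x: "x \<in> base_change s unit_space" for x
  proof -
    have fz: "f z \<in> topspace W"
      using f z by (auto simp: continuous_map_def)
    have "\<alpha> (Loc_unit Z) = \<alpha> (Loc_pullback Z f (Loc_unit W))"
      by (rule tensor_automorphism_eq[OF s \<alpha> Loc_unit_in_Loc P[OF Loc_unit_in_Loc] z pullback_unit_hom[OF f]])
        (simp_all add: stalk z fz Loc_unit_def)
    moreover have "\<alpha> (Loc_unit Z) x = x"
      using \<alpha> x unfolding tensor_automorphisms_def by blast
    ultimately show ?thesis
      unfolding \<beta>[OF Loc_unit_in_Loc] by simp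
  qed
  show ?thesis
    unfolding tensor_automorphisms_def
    by (intro CollectI conjI ballI 1 3 4 5) (use 2 in blast)+
qed

lemma tannaka_map_mult:
  assumes f: "continuous_map Z W f" and z: "z \<in> topspace Z"
  shows "tannaka_map Z W f (monoid.mult (tannaka_group Z z s) \<alpha> \<beta>)
    = monoid.mult (tannaka_group W (f z) s) (tannaka_map Z W f \<alpha>) (tannaka_map Z W f \<beta>)"
proof
  fix E
  show "tannaka_map Z W f (monoid.mult (tannaka_group Z z s) \<alpha> \<beta>) E
    = monoid.mult (tannaka_group W (f z) s) (tannaka_map Z W f \<alpha>) (tannaka_map Z W f \<beta>) E"
    using Loc_pullback_in_Loc[OF f, of E] stalk_pullback[OF z, of f E]
    by (simp add: tannaka_map_def tannaka_group_def restrict_def)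
qed

lemma tannaka_map_base_change:
  assumes f: "continuous_map Z W f" and z: "z \<in> topspace Z"
  shows "tannaka_map Z W f (tannaka_base_change Z z s g \<alpha>)
    = tannaka_base_change W (f z) s g (tannaka_map Z W f \<alpha>)"
proof
  fix E
  show "tannaka_map Z W f (tannaka_base_change Z z s g \<alpha>) E
    = tannaka_base_change W (f z) s g (tannaka_map Z W f \<alpha>) E"
    using Loc_pullback_in_Loc[OF f, of E] stalk_pullback[OF z, of f E]
    by (simp add: tannaka_map_def tannaka_base_change_def restrict_def)
qed

section \<open>Invariance under deformation retraction\<close>

lemma pullback_retract_hom:
  assumes i: "continuous_map W Z i" and r: "continuous_map Z W r"
    and ri: "\<And>w. w \<in> topspace W \<Longrightarrow> r (i w) = w" and E: "E \<in> Loc W"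
  shows "(\<lambda>w v. v) \<in> Loc_hom W (Loc_pullback W i (Loc_pullback Z r E)) E"
proof -
  let ?P = "Loc_pullback Z r E"
  note P = Loc_pullback_in_Loc[OF r E]
  note top = etale_pullback_fst(1)[OF i P]
  have iZ: "i w \<in> topspace Z" if "w \<in> topspace W" for w
    using i that by (auto simp: continuous_map_def)
  have stalk: "stalk (Loc_pullback W i ?P) w = stalk E w" if "w \<in> topspace W" for w
    using that iZ[OF that] ri[OF that] by (simp add: stalk_pullback)
  have "lift_to_etale E (etale (Loc_pullback W i ?P)) (\<lambda>e. r (i (fst e))) snd"
    using lift_to_etale_reparam[OF etale_pullback_fst(3)[OF r E] etale_pullback_fst(3)[OF i P]] by simp
  then have "lift_to_etale E (etale (Loc_pullback W i ?P)) fst snd"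
    by (rule continuous_map_eq) (auto simp: top ri)
  then show ?thesis
    by (intro Loc_homI) (auto simp: linear_on_def stalk)
qed

text \<open>Transport along the deformation is a morphism from \<open>E\<close> to \<open>r\<^sup>* i\<^sup>* E\<close>, and it is
  the identity on the stalk at a point that the deformation fixes.\<close>

lemma pullback_deformation_hom:
  assumes K: "continuous_map (cylinder 0 1 Z UNIV) Z K"
    and K0: "\<And>z. z \<in> topspace Z \<Longrightarrow> K (0, z) = z"
    and K1: "\<And>z. z \<in> topspace Z \<Longrightarrow> K (1, z) = i (r z)"
    and i: "continuous_map W Z i" and r: "continuous_map Z W r" and E: "E \<in> Loc Z"
    and z: "z \<in> topspace Z" "\<forall>t\<in>{0..1}. K (t, z) = z"
  obtains \<phi> where "\<phi> \<in> Loc_hom Z E (Loc_pullback Z r (Loc_pullback W i E))"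
    "\<forall>v\<in>stalk E z. \<phi> z v = v"
proof -
  interpret homotopy_from_id Z K E
    by unfold_locales (fact K E K0)+
  let ?P = "Loc_pullback W i E"
  note P = Loc_pullback_in_Loc[OF i E]
  have rW: "r z \<in> topspace W" if "z \<in> topspace Z" for z
    using r that by (auto simp: continuous_map_def)
  have fst_top: "fst e \<in> topspace Z" if "e \<in> topspace (etale E)" for e
    using that Loc_topspace[OF E] by auto
  have lift: "lift_to_etale E (etale E) (\<lambda>e. i (r (fst e))) (\<lambda>e. transport (fst e) (snd e))"
    by (rule continuous_map_eq[OF lift_to_etale_transport]) (simp add: K1 fst_top)
  have "continuous_map (etale E) W (\<lambda>e. r (fst e))"
    using continuous_map_compose[OF Loc_proj[OF E] r] by (simp add: o_def)
  then have "lift_to_etale ?P (etale E) (\<lambda>e. r (fst e)) (\<lambda>e. transport (fst e) (snd e))"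
    by (intro lift_to_etale_pullbackI[OF E] lift)
  then have lift': "lift_to_etale (Loc_pullback Z r ?P) (etale E) fst (\<lambda>e. transport (fst e) (snd e))"
    by (intro lift_to_etale_pullbackI[OF P] Loc_proj[OF E])
  have "transport \<in> Loc_hom Z E (Loc_pullback Z r ?P)"
  proof (rule Loc_homI[OF transport_linear _ lift'])
    fix z assume z: "z \<in> topspace Z"
    show "transport z ` stalk E z \<subseteq> stalk (Loc_pullback Z r ?P) z"
      using lift_to_etale_stalk(2)[OF Loc_pullback_in_Loc[OF r P] lift', of "(z, _)"] z
      by (auto simp: Loc_topspace[OF E])
  qed
  then show thesis
    by (rule that) (use transport_stationary[OF z(1) _ z(2)] in blast)
qed

text \<open>The inverse is the map induced by \<open>i\<close>: the composites send a tensor automorphism to its values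
  on \<open>r\<^sup>* i\<^sup>* E\<close> and \<open>i\<^sup>* r\<^sup>* E\<close>, which agree with the values on \<open>E\<close> by the
  two morphisms above.\<close>

theorem tannaka_map_iso_of_deformation_retraction:
  fixes Z :: "'z topology" and W :: "'w topology" and s :: "'k::field \<Rightarrow> 'r::comm_ring_1"
  assumes s: "is_ring_hom s" and i: "continuous_map W Z i" and r: "continuous_map Z W r"
    and ri: "\<And>w. w \<in> topspace W \<Longrightarrow> r (i w) = w"
    and K: "continuous_map (cylinder 0 1 Z UNIV) Z K"
    and K0: "\<And>z. z \<in> topspace Z \<Longrightarrow> K (0, z) = z"
    and K1: "\<And>z. z \<in> topspace Z \<Longrightarrow> K (1, z) = i (r z)"
    and z: "z \<in> topspace Z" "\<forall>t\<in>{0..1}. K (t, z) = z"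
  shows "tannaka_map Z W r \<in> iso (tannaka_group Z z s) (tannaka_group W (r z) s)"
proof (rule isoI)
  have w: "r z \<in> topspace W"
    using r z(1) by (auto simp: continuous_map_def)
  have irz: "i (r z) = z"
    using K1[OF z(1)] z(2) by simp
  have into: "tannaka_map Z W r \<alpha> \<in> tensor_automorphisms W (r z) s"
    if "\<alpha> \<in> tensor_automorphisms Z z s" for \<alpha>
    by (rule tannaka_map_in_tensor_automorphisms[OF s r z(1) that])
  have into': "tannaka_map W Z i \<beta> \<in> tensor_automorphisms Z z s"
    if "\<beta> \<in> tensor_automorphisms W (r z) s" for \<beta>
    using tannaka_map_in_tensor_automorphisms[OF s i w that] irz by simp
  show "tannaka_map Z W r \<in> hom (tannaka_group Z z s) (tannaka_group W (r z) s)"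
    using into tannaka_map_mult[OF r z(1)] by (intro homI) (auto simp: tannaka_group_def)
  have "bij_betw (tannaka_map Z W r) (tensor_automorphisms Z z s) (tensor_automorphisms W (r z) s)"
  proof (rule bij_betw_byWitness[of _ "tannaka_map W Z i"])
    show "\<forall>\<alpha>\<in>tensor_automorphisms Z z s. tannaka_map W Z i (tannaka_map Z W r \<alpha>) = \<alpha>"
    proof
      fix \<alpha> assume \<alpha>: "\<alpha> \<in> tensor_automorphisms Z z s"
      have ext: "\<alpha> \<in> extensional (Loc Z)"
        using \<alpha> by (simp add: tensor_automorphisms_def)
      show "tannaka_map W Z i (tannaka_map Z W r \<alpha>) = \<alpha>"
      proof (rule extensionalityI[OF _ ext])
        show "tannaka_map W Z i (tannaka_map Z W r \<alpha>) \<in> extensional (Loc Z)"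
          by (simp add: tannaka_map_def)
        fix E :: "('z, 'k) local_sys" assume E: "E \<in> Loc Z"
        let ?P = "Loc_pullback W i E"
        note P = Loc_pullback_in_Loc[OF i E]
        obtain \<phi> where \<phi>: "\<phi> \<in> Loc_hom Z E (Loc_pullback Z r ?P)" "\<forall>v\<in>stalk E z. \<phi> z v = v"
          using pullback_deformation_hom[OF K K0 K1 i r E z] .
        have "stalk E z = stalk (Loc_pullback Z r ?P) z"
          using irz by (simp add: stalk_pullback z(1) w)
        then have "\<alpha> E = \<alpha> (Loc_pullback Z r ?P)"
          using \<phi>(2) by (intro tensor_automorphism_eq[OF s \<alpha> E Loc_pullback_in_Loc[OF r P] z(1) \<phi>(1)]) auto
        then show "tannaka_map W Z i (tannaka_map Z W r \<alpha>) E = \<alpha> E"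
          using E P by (simp add: tannaka_map_def)
      qed
    qed
    show "\<forall>\<beta>\<in>tensor_automorphisms W (r z) s. tannaka_map Z W r (tannaka_map W Z i \<beta>) = \<beta>"
    proof
      fix \<beta> assume \<beta>: "\<beta> \<in> tensor_automorphisms W (r z) s"
      have ext: "\<beta> \<in> extensional (Loc W)"
        using \<beta> by (simp add: tensor_automorphisms_def)
      show "tannaka_map Z W r (tannaka_map W Z i \<beta>) = \<beta>"
      proof (rule extensionalityI[OF _ ext])
        show "tannaka_map Z W r (tannaka_map W Z i \<beta>) \<in> extensional (Loc W)"
          by (simp add: tannaka_map_def)
        fix E :: "('w, 'k) local_sys" assume E: "E \<in> Loc W"
        let ?P = "Loc_pullback Z r E"
        note P = Loc_pullback_in_Loc[OF r E]
        have "stalk (Loc_pullback W i ?P) (r z) = stalk E (r z)"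
          using irz by (simp add: stalk_pullback z(1) w)
        then have "\<beta> (Loc_pullback W i ?P) = \<beta> E"
          by (intro tensor_automorphism_eq[OF s \<beta> Loc_pullback_in_Loc[OF i P] E w
                pullback_retract_hom[OF i r ri E]]) auto
        then show "tannaka_map Z W r (tannaka_map W Z i \<beta>) E = \<beta> E"
          using E P by (simp add: tannaka_map_def)
      qed
    qed
  qed (use into into' in auto)
  then show "bij_betw (tannaka_map Z W r) (carrier (tannaka_group Z z s)) (carrier (tannaka_group W (r z) s))"
    by (simp add: tannaka_group_def)
qed

section \<open>The radial deformation of characters\<close>

text \<open>The path \<open>\<psi> |\<psi>|\<^sup>-\<^sup>t\<close> from \<open>\<psi>\<close> at \<open>t = 0\<close> to \<open>\<psi> / |\<psi>|\<close> at \<open>t = 1\<close>.\<close>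

definition radial_scale :: "real \<Rightarrow> ('a::field \<Rightarrow> complex) \<Rightarrow> 'a \<Rightarrow> complex"
  where "radial_scale t \<psi> = (\<lambda>a\<in>UNIV - {0}. \<psi> a / complex_of_real (cmod (\<psi> a) powr t))"

lemma unitarize_eq_radial_scale: "unitarize = radial_scale 1"
  by (simp add: fun_eq_iff unitarize_def radial_scale_def)

lemma KS_character_one:
  assumes "\<psi> \<in> KS_characters \<iota>"
  shows "\<psi> 1 = 1"
proof -
  have mult: "\<forall>a b. a \<noteq> 0 \<longrightarrow> b \<noteq> 0 \<longrightarrow> \<psi> (a * b) = \<psi> a * \<psi> b" and "\<psi> 1 \<noteq> 0"
    using assms by (auto simp: KS_characters_def PiE_iff)
  then show ?thesis
    using mult[rule_format, of 1 1] by simp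
qed

lemma norm_KS_character_root_of_unity:
  assumes \<psi>: "\<psi> \<in> KS_characters \<iota>" and "\<zeta> \<in> roots_of_unity"
  shows "cmod (\<psi> \<zeta>) = 1"
proof -
  obtain n where n: "n > 0" "\<zeta> ^ n = 1"
    using assms(2) by (auto simp: roots_of_unity_def)
  then have "\<zeta> \<noteq> 0"
    by (metis power_0_left neq0_conv zero_neq_one)
  have "\<psi> (\<zeta> ^ m) = \<psi> \<zeta> ^ m" for m
  proof (induction m)
    case 0
    then show ?case
      by (simp add: KS_character_one[OF \<psi>])
  next
    case (Suc m)
    have "\<psi> (\<zeta> * \<zeta> ^ m) = \<psi> \<zeta> * \<psi> (\<zeta> ^ m)"
      using \<psi> \<open>\<zeta> \<noteq> 0\<close> by (simp add: KS_characters_def)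
    then show ?case
      by (simp add: Suc.IH)
  qed
  from this[of n] have "\<psi> \<zeta> ^ n = 1"
    using n(2) KS_character_one[OF \<psi>] by simp
  from power_eq_1_iff[OF this] n(1) show ?thesis
    by simp
qed

text \<open>Radial scaling keeps the prescribed values at roots of unity because a character has
  absolute value one there.\<close>

lemma radial_scale_in_KS_characters:
  assumes \<psi>: "\<psi> \<in> KS_characters \<iota>"
  shows "radial_scale t \<psi> \<in> KS_characters \<iota>"
proof -
  have nz: "\<psi> a \<noteq> 0" if "a \<noteq> 0" for a
    using \<psi> that by (auto simp: KS_characters_def PiE_iff)
  have mult: "\<psi> (a * b) = \<psi> a * \<psi> b" if "a \<noteq> 0" "b \<noteq> 0" for a b
    using \<psi> that by (simp add: KS_characters_def)
  have "radial_scale t \<psi> (a * b) = radial_scale t \<psi> a * radial_scale t \<psi> b"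
    if "a \<noteq> 0" "b \<noteq> 0" for a b
    using that by (simp add: radial_scale_def mult norm_mult powr_mult)
  moreover have "radial_scale t \<psi> \<zeta> = \<iota> \<zeta>" if "\<zeta> \<in> roots_of_unity" for \<zeta>
  proof -
    have "\<zeta> \<noteq> 0"
      using that by (auto simp: roots_of_unity_def power_0_left)
    then show ?thesis
      using norm_KS_character_root_of_unity[OF \<psi> that] \<psi> that
      by (simp add: radial_scale_def KS_characters_def)
  qed
  ultimately show ?thesis
    using nz by (simp add: KS_characters_def PiE_iff radial_scale_def)
qed

lemma topspace_KS_closure: "topspace (KS_closure \<iota>) = KS_characters \<iota>"
  by (auto simp: KS_closure_def KS_characters_def PiE_iff extensional_def)

lemma continuous_map_radial_scale:
  "continuous_map (cylinder 0 1 (KS_closure \<iota>) UNIV) (KS_closure \<iota>) (\<lambda>y. radial_scale (fst y) (snd y))"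
proof -
  let ?C = "cylinder 0 1 (KS_closure \<iota>) UNIV"
  have "continuous_map ?C euclidean (\<lambda>y. radial_scale (fst y) (snd y) a)" if a: "a \<noteq> 0" for a :: 'a
  proof -
    \<comment> \<open>The powers \<open>|c|\<^sup>t\<close> are jointly continuous only away from \<open>c = 0\<close>.\<close>
    let ?D = "{0..1} \<times> (UNIV - {0}) :: (real \<times> complex) set"
    have "continuous_map (product_topology (\<lambda>_. euclidean) (UNIV - {0})) (euclidean :: complex topology) (\<lambda>\<psi>. \<psi> a)"
      using a by (intro continuous_map_product_projection) simp
    then have "continuous_map (KS_closure \<iota>) euclidean (\<lambda>\<psi>. \<psi> a)"
      unfolding KS_closure_def by (rule continuous_map_from_subtopology)
    from continuous_map_compose[OF continuous_map_snd this]
    have ev: "continuous_map ?C euclidean (\<lambda>y. snd y a)"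
      by (simp add: o_def)
    have time: "continuous_map ?C euclidean fst"
      using continuous_map_fst[of "top_of_set {0..1}" "KS_closure \<iota>"]
      by (auto simp add: continuous_map_in_subtopology)
    have "continuous_map ?C (prod_topology euclidean euclidean) (\<lambda>y. (fst y, snd y a))"
      using ev time by (simp add: continuous_map_pairwise o_def del: prod_topology_euclidean)
    moreover have "(fst y, snd y a) \<in> ?D" if "y \<in> topspace ?C" for y
      using that a by (auto simp: topspace_KS_closure KS_characters_def PiE_iff)
    ultimately have "continuous_map ?C (top_of_set ?D) (\<lambda>y. (fst y, snd y a))"
      by (auto simp: continuous_map_in_subtopology)
    moreover have "continuous_map (top_of_set ?D) euclidean
        (\<lambda>p. snd p / complex_of_real (cmod (snd p) powr fst p))"
      unfolding continuous_map_iff_continuous by (intro continuous_intros) auto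
    ultimately have "continuous_map ?C euclidean
        ((\<lambda>p. snd p / complex_of_real (cmod (snd p) powr fst p)) \<circ> (\<lambda>y. (fst y, snd y a)))"
      by (rule continuous_map_compose)
    then show ?thesis
      using a by (simp add: radial_scale_def o_def)
  qed
  then have "continuous_map ?C (product_topology (\<lambda>_. euclidean) (UNIV - {0})) (\<lambda>y. radial_scale (fst y) (snd y))"
    by (auto simp: continuous_map_componentwise radial_scale_def)
  moreover have "radial_scale (fst y) (snd y) \<in> KS_characters \<iota>" if "y \<in> topspace ?C" for y
    using that by (auto simp: topspace_KS_closure intro: radial_scale_in_KS_characters)
  ultimately show ?thesis
    unfolding KS_closure_def[of \<iota>] by (auto simp: continuous_map_in_subtopology)
qed

lemma radial_scale_zero:
  assumes "\<psi> \<in> KS_characters \<iota>"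
  shows "radial_scale 0 \<psi> = \<psi>"
proof -
  have "\<psi> \<in> extensional (UNIV - {0})" "\<And>a. a \<noteq> 0 \<Longrightarrow> \<psi> a \<noteq> 0"
    using assms by (auto simp: KS_characters_def PiE_iff)
  then show ?thesis
    by (auto simp: radial_scale_def fun_eq_iff extensional_def)
qed

lemma topspace_KS_unitary_closure:
  "topspace (KS_unitary_closure \<iota>) = {\<psi> \<in> KS_characters \<iota>. \<forall>a. a \<noteq> 0 \<longrightarrow> cmod (\<psi> a) = 1}"
  by (auto simp: KS_unitary_closure_def topspace_KS_closure)

lemma radial_scale_unitary:
  assumes "\<psi> \<in> topspace (KS_unitary_closure \<iota>)"
  shows "radial_scale t \<psi> = \<psi>"
proof -
  have "\<psi> \<in> extensional (UNIV - {0})" "\<And>a. a \<noteq> 0 \<Longrightarrow> cmod (\<psi> a) = 1"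
    using assms by (auto simp: topspace_KS_unitary_closure KS_characters_def PiE_iff)
  then show ?thesis
    by (auto simp: radial_scale_def fun_eq_iff extensional_def)
qed

lemma unitarize_in_KS_unitary_closure:
  assumes "\<psi> \<in> KS_characters \<iota>"
  shows "unitarize \<psi> \<in> topspace (KS_unitary_closure \<iota>)"
proof -
  have "cmod (unitarize \<psi> a) = 1" if "a \<noteq> 0" for a
    using assms that by (auto simp: unitarize_def norm_divide KS_characters_def PiE_iff)
  then show ?thesis
    using radial_scale_in_KS_characters[OF assms, of 1]
    by (simp add: topspace_KS_unitary_closure unitarize_eq_radial_scale)
qed

section \<open>Descent to Galois orbits\<close>

text \<open>Scaling acts on values of a character and the Galois group on arguments, so the two commute.\<close>

lemma radial_scale_galois_orbit:
  "radial_scale t ` galois_orbit F \<psi> = galois_orbit F (radial_scale t \<psi>)"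
proof -
  have *: "radial_scale t (\<psi> \<circ> \<gamma>) = radial_scale t \<psi> \<circ> \<gamma>" if "\<gamma> \<in> galois_group F" for \<gamma>
  proof -
    have bij: "bij \<gamma>"
      using that by (simp add: galois_group_def ring_iso_def ring_of_type_algebra_def)
    have "\<gamma> 0 = 0"
      using that by (intro is_ring_hom_zero) (simp add: galois_group_def ring_iso_def)
    then have "\<gamma> a = 0 \<longleftrightarrow> a = 0" for a
      using bij by (metis bij_pointE)
    then show ?thesis
      by (auto simp: radial_scale_def fun_eq_iff)
  qed
  show ?thesis
    unfolding galois_orbit_def by (auto simp: * image_iff) (use * in metis)
qed

lemma KS_space_cases:
  assumes "P \<in> topspace (KS_space F \<iota>)"
  obtains \<psi> where "\<psi> \<in> KS_characters \<iota>" "P = galois_orbit F \<psi>"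
  using assms by (auto simp: KS_space_def topspace_quotient_topology topspace_KS_closure)

lemma KS_compact_space_cases:
  assumes "P \<in> topspace (KS_compact_space F \<iota>)"
  obtains \<psi> where "\<psi> \<in> topspace (KS_unitary_closure \<iota>)" "P = galois_orbit F \<psi>"
  using assms by (auto simp: KS_compact_space_def topspace_quotient_topology)

lemma continuous_map_KS_inclusion:
  "continuous_map (KS_compact_space F \<iota>) (KS_space F \<iota>) (\<lambda>P. P)"
  unfolding KS_compact_space_def
proof (rule continuous_compose_quotient_map[OF quotient_map_quotient_topology])
  have "continuous_map (KS_closure \<iota>) (KS_space F \<iota>) (galois_orbit F)"
    unfolding KS_space_def by (intro quotient_imp_continuous_map quotient_map_quotient_topology)
  then show "continuous_map (KS_unitary_closure \<iota>) (KS_space F \<iota>) ((\<lambda>P. P) \<circ> galois_orbit F)"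
    by (simp add: KS_unitary_closure_def o_def continuous_map_from_subtopology)
qed

lemma continuous_map_unitarize:
  "continuous_map (KS_closure \<iota>) (KS_unitary_closure \<iota>) unitarize"
proof -
  have "continuous_map (KS_closure \<iota>) (cylinder 0 1 (KS_closure \<iota>) UNIV) (\<lambda>\<psi>. (1, \<psi>))"
    by (simp add: continuous_map_pairwise o_def)
  from continuous_map_compose[OF this continuous_map_radial_scale]
  have "continuous_map (KS_closure \<iota>) (KS_closure \<iota>) unitarize"
    by (simp add: o_def unitarize_eq_radial_scale)
  then show ?thesis
    using unitarize_in_KS_unitary_closure[of _ \<iota>]
    by (auto simp: KS_unitary_closure_def continuous_map_in_subtopology topspace_KS_closure)
qed

lemma continuous_map_KS_retraction:
  "continuous_map (KS_space F \<iota>) (KS_compact_space F \<iota>) KS_retraction"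
  unfolding KS_space_def
proof (rule continuous_compose_quotient_map[OF quotient_map_quotient_topology])
  have "continuous_map (KS_unitary_closure \<iota>) (KS_compact_space F \<iota>) (galois_orbit F)"
    unfolding KS_compact_space_def by (intro quotient_imp_continuous_map quotient_map_quotient_topology)
  from continuous_map_compose[OF continuous_map_unitarize this]
  show "continuous_map (KS_closure \<iota>) (KS_compact_space F \<iota>) (KS_retraction \<circ> galois_orbit F)"
    by (simp add: o_def KS_retraction_orbit)
qed

text \<open>The homotopy descends because the unit interval is locally compact, so that its product with
  the quotient map is again a quotient map.\<close>

lemma continuous_map_KS_homotopy:
  "continuous_map (cylinder 0 1 (KS_space F \<iota>) UNIV) (KS_space F \<iota>) (\<lambda>y. radial_scale (fst y) ` snd y)"
proof -
  let ?I = "top_of_set {0..1::real}"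
  have "compact_space ?I"
    by (simp add: compact_space_subtopology)
  then have "locally_compact_space ?I"
    by (rule compact_imp_locally_compact_space)
  moreover have "Hausdorff_space ?I"
    by (simp add: Hausdorff_space_subtopology)
  ultimately have q: "quotient_map (prod_topology ?I (KS_closure \<iota>)) (prod_topology ?I (KS_space F \<iota>))
      (\<lambda>(t, \<psi>). (t, galois_orbit F \<psi>))"
    unfolding KS_space_def by (intro quotient_map_prod_right disjI1 quotient_map_quotient_topology)
  have "continuous_map (KS_closure \<iota>) (KS_space F \<iota>) (galois_orbit F)"
    unfolding KS_space_def by (intro quotient_imp_continuous_map quotient_map_quotient_topology)
  from continuous_map_compose[OF continuous_map_radial_scale this]
  have "continuous_map (prod_topology ?I (KS_closure \<iota>)) (KS_space F \<iota>)
      ((\<lambda>y. radial_scale (fst y) ` snd y) \<circ> (\<lambda>(t, \<psi>). (t, galois_orbit F \<psi>)))"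
    by (simp add: o_def case_prod_unfold radial_scale_galois_orbit)
  from continuous_compose_quotient_map[OF q this] show ?thesis
    by simp
qed

theorem corollary5p6:
  fixes F :: "'a::field_char_0 set"
    and \<iota> :: "'a \<Rightarrow> complex"
    and x :: "('a \<Rightarrow> complex) set"
    and s :: "'k::field \<Rightarrow> 'r::comm_ring_1"
    and g :: "'r \<Rightarrow> 'q::comm_ring_1"
  assumes "algebraic_closure (ring_of_type_algebra :: 'a ring) F"
    and "(roots_of_unity :: 'a set) \<subseteq> F"
    and "inj_on \<iota> roots_of_unity"
    and "\<forall>\<zeta>\<in>roots_of_unity. \<iota> \<zeta> \<noteq> 0"
    and "\<forall>\<zeta>\<in>roots_of_unity. \<forall>\<xi>\<in>roots_of_unity. \<iota> (\<zeta> * \<xi>) = \<iota> \<zeta> * \<iota> \<xi>"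
    and "x \<in> topspace (KS_compact_space F \<iota>)"
    and "is_ring_hom s"
    and "is_ring_hom g"
  shows "x \<in> topspace (KS_space F \<iota>) \<and>
    continuous_map (KS_space F \<iota>) (KS_compact_space F \<iota>) KS_retraction \<and>
    KS_retraction x = x \<and>
    tannaka_map (KS_space F \<iota>) (KS_compact_space F \<iota>) KS_retraction
      \<in> iso (tannaka_group (KS_space F \<iota>) x s) (tannaka_group (KS_compact_space F \<iota>) x s) \<and>
    (\<forall>\<alpha>\<in>carrier (tannaka_group (KS_space F \<iota>) x s).
      tannaka_map (KS_space F \<iota>) (KS_compact_space F \<iota>) KS_retraction
          (tannaka_base_change (KS_space F \<iota>) x s g \<alpha>)
        = tannaka_base_change (KS_compact_space F \<iota>) x s g
            (tannaka_map (KS_space F \<iota>) (KS_compact_space F \<iota>) KS_retraction \<alpha>))"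
proof (intro conjI)
  let ?Z = "KS_space F \<iota>" and ?W = "KS_compact_space F \<iota>"
  let ?K = "\<lambda>y :: real \<times> ('a \<Rightarrow> complex) set. radial_scale (fst y) ` snd y"
  have stat: "radial_scale t ` P = P" if "P \<in> topspace ?W" for t P
    using that by (elim KS_compact_space_cases) (simp add: radial_scale_galois_orbit radial_scale_unitary)
  have fixed: "KS_retraction P = P" if "P \<in> topspace ?W" for P
    using stat[OF that, of 1] by (simp add: KS_retraction_def unitarize_eq_radial_scale)
  show x: "x \<in> topspace ?Z"
    using continuous_map_image_subset_topspace[OF continuous_map_KS_inclusion] assms(6) by blast
  show "continuous_map ?Z ?W KS_retraction"
    by (rule continuous_map_KS_retraction)
  show rx: "KS_retraction x = x"
    by (rule fixed[OF assms(6)])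
  have "tannaka_map ?Z ?W KS_retraction
      \<in> iso (tannaka_group ?Z x s) (tannaka_group ?W (KS_retraction x) s)"
  proof (rule tannaka_map_iso_of_deformation_retraction[OF assms(7) continuous_map_KS_inclusion
        continuous_map_KS_retraction fixed continuous_map_KS_homotopy])
    show "?K (0, P) = P" if "P \<in> topspace ?Z" for P
      using that by (elim KS_space_cases) (simp add: radial_scale_galois_orbit radial_scale_zero)
    show "?K (1, P) = KS_retraction P" for P
      by (simp add: KS_retraction_def unitarize_eq_radial_scale)
    show "\<forall>t\<in>{0..1}. ?K (t, x) = x"
      using stat[OF assms(6)] by simp
  qed (use x in auto)
  then show "tannaka_map ?Z ?W KS_retraction \<in> iso (tannaka_group ?Z x s) (tannaka_group ?W x s)"
    by (simp only: rx)
  show "\<forall>\<alpha>\<in>carrier (tannaka_group ?Z x s).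
      tannaka_map ?Z ?W KS_retraction (tannaka_base_change ?Z x s g \<alpha>)
        = tannaka_base_change ?W x s g (tannaka_map ?Z ?W KS_retraction \<alpha>)"
    using tannaka_map_base_change[OF continuous_map_KS_retraction x, of s g] unfolding rx by blast
qed

end
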